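(* Assume that $\underline E=\prod_{p\in\mathbb P}E_p$ is a compact subset of $\widehat{\mathbb Z}=\prod_{p\in\mathbb P}\mathbb Z_p$ (with $E_p\subseteq\mathbb Z_p$) such that, for each $p\in\mathbb P$, $E_p$ is infinite and, for each $n\ge0$, $\#(E_p\bmod p)>n$ for all but finitely many $p\in\mathbb P$. Then: 1) There exists a sequence $\{\underline\alpha_n\}_{n\ge0}$ which is an adelic ordering of $\underline E$, and the corresponding polynomials $$\underline g_n(x)=\prod_{k=0}^{n-1}\frac{x-\underline\alpha_k}{\underline\alpha_n-\underline\alpha_k}\qquad(n\ge 0)$$ form a basis of the $\widehat{\mathbb Z}$-module $\mathrm{Int}_{\mathcal A_f(\mathbb Q)}(\underline E,\widehat{\mathbb Z})$. 2) Every $\underline\varphi\in\prod_{p\in\mathbb P}\mathcal C(E_p,\mathbb Z_p)$ may be uniquely written as a uniformly convergent series in the $\underline g_n$'s with coefficients in $\widehat{\mathbb Z}$: $$\underline\varphi(x)=\sum_{n\ge0}\underline c_n\,\underline g_n(x)\quad\text{where }\underline c_n\in\widehat{\mathbb Z}\text{ and }\lim_{n\to+\infty}\underline c_n=\underline 0.$$ 3) The $\underline c_n$'s satisfy the recursive formula $$\underline c_n=\underline\varphi(\underline\alpha_n)-\sum_{k=0}^{n-1}\underline c_k\,\underline g_k(\underline\alpha_n),$$ and one has, for every $p\in\mathbb P$, $$\inf_{n\ge0}v_p(\pi_p(\underline c_n))=\inf_{\underline y\in\underline E}v_p(\pi_p(\underline\varphi(\underline y))).$$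
   Context: $\mathbb P$ is the set of primes; $\widehat{\mathbb Z}=\prod_p\mathbb Z_p$ has the product topology. $\mathcal A_f(\mathbb Q)$ is the ring of finite adèles of $\mathbb Q$ (the restricted product of the $\mathbb Q_p$ with respect to the $\mathbb Z_p$, with the restricted product topology), and $\pi_p$ is the projection onto $\mathbb Q_p$; $v_p$ is the $p$-adic valuation. $\#(E_p\bmod p)$ is the cardinality of the image of $E_p$ in $\mathbb Z_p/p\mathbb Z_p$. A polynomial $\underline g\in\mathcal A_f(\mathbb Q)[x]$ has components $g_p\in\mathbb Q_p[x]$ and is evaluated by $\underline g((\alpha_p)_p)=(g_p(\alpha_p))_p$. $\mathrm{Int}_{\mathcal A_f(\mathbb Q)}(\underline E,\widehat{\mathbb Z})=\{\underline g\in\mathcal A_f(\mathbb Q)[x]\mid\underline g(\underline E)\subseteq\widehat{\mathbb Z}\}$. An adelic ordering of $\underline E$ is a sequence $\{\underline\alpha_n\}_{n\ge0}$ of elements of $\underline E$ such that: (a) for all $p\in\mathbb P$ and all $n\ge1$, $v_p\big(\pi_p(\prod_{k=0}^{n-1}(\underline\alpha_n-\underline\alpha_k))\big)=\min_{\underline y\in\underline E}v_p\big(\pi_p(\prod_{k=0}^{n-1}(\underline y-\underline\alpha_k))\big)$; (b) for all $n\ge1$, $v_p\big(\pi_p(\prod_{k=0}^{n-1}(\underline\alpha_n-\underline\alpha_k))\big)=0$ for all but finitely many $p\in\mathbb P$. $\mathcal C(E_p,\mathbb Z_p)$ is the ring of continuous functions $E_p\to\mathbb Z_p$; $\underline\varphi=(\varphi_p)_p\in\prod_p\mathcal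 C(E_p,\mathbb Z_p)$ is regarded as the function $\underline E\to\widehat{\mathbb Z}$, $(\alpha_p)_p\mapsto(\varphi_p(\alpha_p))_p$. *)

theory Defs
  imports
    "HOL-Analysis.Analysis"
    "HOL-Algebra.QuotRing"
    "HOL-Computational_Algebra.Primes"
    "HOL-Computational_Algebra.Polynomial"
begin

section \<open>The fields of \<open>p\<close>-adic numbers\<close>

text \<open>Valuations take values in \<open>ereal\<close>: the value is an integer, or \<open>\<infinity>\<close> at zero.\<close>

definition rat_val :: "nat \<Rightarrow> rat \<Rightarrow> ereal" where
  "rat_val p r =
     (if r = 0 then \<infinity>
      else ereal (of_int (int (multiplicity (int p) (fst (quotient_of r)))
                          - int (multiplicity (int p) (snd (quotient_of r))))))"

text \<open>
  The field of \<open>p\<close>-adic numbers is the completion of the rationals: the ring of sequences that are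
  Cauchy for the \<open>p\<close>-adic valuation, modulo the ideal of sequences that tend to zero. All these
  fields live in one type, so that families indexed by the primes can be formed. Only prime \<open>p\<close>
  are meaningful.
\<close>

type_synonym padic = "(nat \<Rightarrow> rat) set"

definition cauchy_ring :: "nat \<Rightarrow> (nat \<Rightarrow> rat) ring" where
  "cauchy_ring p =
     \<lparr>carrier = {s. \<forall>k::nat. \<exists>N. \<forall>m\<ge>N. \<forall>n\<ge>N. ereal (real k) \<le> rat_val p (s m - s n)},
      mult = (\<lambda>s t n. s n * t n), one = (\<lambda>n. 1), zero = (\<lambda>n. 0), add = (\<lambda>s t n. s n + t n)\<rparr>"

definition null_ideal :: "nat \<Rightarrow> (nat \<Rightarrow> rat) set" where
  "null_ideal p = {s. \<forall>k::nat. \<exists>N. \<forall>n\<ge>N. ereal (real k) \<le> rat_val p (s n)}"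

definition Qp :: "nat \<Rightarrow> padic ring" where
  "Qp p = cauchy_ring p Quot null_ideal p"

definition padic_val :: "nat \<Rightarrow> padic \<Rightarrow> ereal" where
  "padic_val p X = (THE v. \<forall>s\<in>X. (\<lambda>n. rat_val p (s n)) \<longlonglongrightarrow> v)"

definition Zp :: "nat \<Rightarrow> padic ring" where
  "Zp p = (Qp p)\<lparr>carrier := {x \<in> carrier (Qp p). 0 \<le> padic_val p x}\<rparr>"

definition padic_dist :: "nat \<Rightarrow> padic \<Rightarrow> padic \<Rightarrow> real" where
  "padic_dist p x y =
     (if x \<in> carrier (Qp p) \<and> y \<in> carrier (Qp p) \<and> x \<noteq> y
      then real p powr (- real_of_ereal (padic_val p (x \<ominus>\<^bsub>Qp p\<^esub> y))) else 0)"

definition Qp_topology :: "nat \<Rightarrow> padic topology" where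
  "Qp_topology p = Metric_space.mtopology (carrier (Qp p)) (padic_dist p)"

definition Zp_topology :: "nat \<Rightarrow> padic topology" where
  "Zp_topology p = subtopology (Qp_topology p) (carrier (Zp p))"

definition p_ideal :: "nat \<Rightarrow> padic set" where
  "p_ideal p = (\<lambda>x. [p] \<cdot>\<^bsub>Zp p\<^esub> x) ` carrier (Zp p)"

definition mod_p :: "nat \<Rightarrow> padic set \<Rightarrow> padic set set" where
  "mod_p p A = (\<lambda>x. p_ideal p +>\<^bsub>Zp p\<^esub> x) ` A"


subsection \<open>Ring structure and valuation\<close>

lemma rat_val_frac:
  assumes "prime p" "a \<noteq> 0" "b \<noteq> 0"
  shows "rat_val p (of_int a / of_int b) =
           ereal (of_int (int (multiplicity (int p) a) - int (multiplicity (int p) b)))"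
proof -
  define r :: rat where "r = of_int a / of_int b"
  obtain c d where cd: "quotient_of r = (c, d)" by fastforce
  have d: "d > 0" using quotient_of_denom_pos[OF cd] .
  have r: "r = of_int c / of_int d" using quotient_of_div[OF cd] .
  have r0: "r \<noteq> 0" using assms by (simp add: r_def)
  then have c: "c \<noteq> 0" using r by auto
  have "of_int a * of_int d = (of_int c * of_int b :: rat)"
    using r assms d unfolding r_def by (simp add: field_simps)
  then have eq: "a * d = c * b" by (metis of_int_eq_iff of_int_mult)
  have pe: "prime_elem (int p)" using assms(1) by simp
  have "multiplicity (int p) a + multiplicity (int p) d = multiplicity (int p) c + multiplicity (int p) b"
    using prime_elem_multiplicity_mult_distrib[OF pe, of a d]
      prime_elem_multiplicity_mult_distrib[OF pe, of c b] eq assms c d by auto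
  then have "int (multiplicity (int p) c) - int (multiplicity (int p) d) =
      int (multiplicity (int p) a) - int (multiplicity (int p) b)" by linarith
  then show ?thesis using cd r0 unfolding r_def[symmetric] rat_val_def by simp
qed

lemma rat_fracE:
  fixes r :: rat
  assumes "r \<noteq> 0"
  obtains a b where "a \<noteq> 0" "b \<noteq> 0" "r = of_int a / of_int b"
proof -
  obtain c d where cd: "quotient_of r = (c, d)" by fastforce
  show ?thesis
    using that[of c d] quotient_of_div[OF cd] quotient_of_denom_pos[OF cd] assms by auto
qed

lemma rat_val_0 [simp]: "rat_val p 0 = \<infinity>"
  by (simp add: rat_val_def)

lemma rat_val_1 [simp]: "rat_val p 1 = 0"
  by (simp add: rat_val_def zero_ereal_def)

lemma rat_val_int: "rat_val p r = \<infinity> \<or> (\<exists>k::int. rat_val p r = ereal (of_int k))"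
  unfolding rat_val_def by (cases "r = 0") (simp, metis)

lemma rat_val_nz: "r \<noteq> 0 \<Longrightarrow> \<exists>k::int. rat_val p r = ereal (of_int k)"
  unfolding rat_val_def by metis

lemma rat_val_eq_infinity_iff: "rat_val p r = \<infinity> \<longleftrightarrow> r = 0"
  by (simp add: rat_val_def)

lemma rat_val_mult:
  assumes "prime p"
  shows "rat_val p (r * s) = rat_val p r + rat_val p s"
proof (cases "r = 0 \<or> s = 0")
  case True
  then show ?thesis by (auto simp: rat_val_def)
next
  case False
  obtain a b where ab: "a \<noteq> 0" "b \<noteq> 0" "r = of_int a / of_int b" using False rat_fracE by metis
  obtain c d where cd: "c \<noteq> 0" "d \<noteq> 0" "s = of_int c / of_int d" using False rat_fracE by metis
  have pe: "prime_elem (int p)" using assms(1) by simp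
  have "r * s = of_int (a * c) / of_int (b * d)" using ab cd by simp
  then have "rat_val p (r * s) = ereal (of_int (int (multiplicity (int p) (a * c)) - int (multiplicity (int p) (b * d))))"
    using rat_val_frac[OF assms, of "a * c" "b * d"] ab(1,2) cd(1,2) by simp
  then show ?thesis
    using prime_elem_multiplicity_mult_distrib[OF pe, of a c]
      prime_elem_multiplicity_mult_distrib[OF pe, of b d] ab(1,2) cd(1,2)
    by (simp add: ab(3) cd(3) rat_val_frac[OF assms])
qed

lemma rat_val_minus [simp]:
  "rat_val p (- r) = rat_val p r"
  by (simp add: rat_val_def rat_uminus_code Let_def case_prod_beta multiplicity_def)

lemma rat_val_add:
  assumes "prime p"
  shows "min (rat_val p r) (rat_val p s) \<le> rat_val p (r + s)"
proof (cases "r = 0 \<or> s = 0 \<or> r + s = 0")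
  case True
  then show ?thesis by auto
next
  case False
  obtain a b where ab: "a \<noteq> 0" "b \<noteq> 0" "r = of_int a / of_int b" using False rat_fracE by metis
  obtain c d where cd: "c \<noteq> 0" "d \<noteq> 0" "s = of_int c / of_int d" using False rat_fracE by metis
  let ?m = "multiplicity (int p)"
  have pe: "prime_elem (int p)" using assms(1) by simp
  have r: "r = of_int (a * d) / of_int (b * d)" and s: "s = of_int (c * b) / of_int (b * d)"
    using ab cd by simp_all
  have rs: "r + s = of_int (a * d + c * b) / of_int (b * d)"
    unfolding r s by (simp add: add_divide_distrib)
  have nz: "a * d + c * b \<noteq> 0" using False unfolding rs by force
  have "int p ^ min (?m (a * d)) (?m (c * b)) dvd a * d + c * b"
    by (intro dvd_add multiplicity_dvd') auto
  then have "min (?m (a * d)) (?m (c * b)) \<le> ?m (a * d + c * b)"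
    using nz pe by (intro multiplicity_geI) (auto simp: prime_elem_def)
  then have "min (int (?m (a * d)) - int (?m (b * d))) (int (?m (c * b)) - int (?m (b * d)))
      \<le> int (?m (a * d + c * b)) - int (?m (b * d))" by linarith
  then have "min (real_of_int (int (?m (a * d)) - int (?m (b * d)))) (of_int (int (?m (c * b)) - int (?m (b * d))))
      \<le> of_int (int (?m (a * d + c * b)) - int (?m (b * d)))"
    by (metis of_int_le_iff of_int_min)
  then show ?thesis
    unfolding rs unfolding r s
    using ab(1,2) cd(1,2) nz
    by (simp only: rat_val_frac[OF assms] mult_eq_0_iff ereal_min[symmetric] ereal_less_eq not_False_eq_True de_Morgan_disj simp_thms)
qed

lemma rat_val_diff: "prime p \<Longrightarrow> min (rat_val p r) (rat_val p s) \<le> rat_val p (r - s)"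
  using rat_val_add[of p r "- s"] by simp

lemma cauchy_ring_simps [simp]:
  "mult (cauchy_ring p) = (\<lambda>s t n. s n * t n)" "one (cauchy_ring p) = (\<lambda>n. 1)"
  "zero (cauchy_ring p) = (\<lambda>n. 0)" "add (cauchy_ring p) = (\<lambda>s t n. s n + t n)"
  by (simp_all add: cauchy_ring_def)

lemma cauchy_ring_iff:
  "s \<in> carrier (cauchy_ring p) \<longleftrightarrow>
     (\<forall>k::nat. \<exists>N. \<forall>m\<ge>N. \<forall>n\<ge>N. ereal (real k) \<le> rat_val p (s m - s n))"
  by (simp add: cauchy_ring_def)

lemma null_ideal_iff:
  "s \<in> null_ideal p \<longleftrightarrow> (\<forall>k::nat. \<exists>N. \<forall>n\<ge>N. ereal (real k) \<le> rat_val p (s n))"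
  by (simp add: null_ideal_def)

lemma null_ideal_iff_tendsto: "s \<in> null_ideal p \<longleftrightarrow> (\<lambda>n. rat_val p (s n)) \<longlonglongrightarrow> \<infinity>"
proof
  assume s: "s \<in> null_ideal p"
  show "(\<lambda>n. rat_val p (s n)) \<longlonglongrightarrow> \<infinity>"
    unfolding tendsto_PInfty
  proof
    fix r :: real
    obtain k :: nat where k: "r < real k" using reals_Archimedean2 by blast
    obtain N where "\<forall>n\<ge>N. ereal (real k) \<le> rat_val p (s n)" using s null_ideal_iff by metis
    then show "\<forall>\<^sub>F x in sequentially. ereal r < rat_val p (s x)"
      using k unfolding eventually_sequentially
      by (metis ereal_less(2) less_ereal.simps(1) less_le_trans)
  qed
next
  assume "(\<lambda>n. rat_val p (s n)) \<longlonglongrightarrow> \<infinity>"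
  then show "s \<in> null_ideal p"
    unfolding tendsto_PInfty null_ideal_iff eventually_sequentially
    by (meson less_imp_le)
qed

lemma null_subset_cauchy:
  assumes "prime p" shows "null_ideal p \<subseteq> carrier (cauchy_ring p)"
proof
  fix s assume s: "s \<in> null_ideal p"
  show "s \<in> carrier (cauchy_ring p)"
    unfolding cauchy_ring_iff
  proof
    fix k :: nat
    obtain N where N: "\<forall>n\<ge>N. ereal (real k) \<le> rat_val p (s n)" using s null_ideal_iff by metis
    show "\<exists>N. \<forall>m\<ge>N. \<forall>n\<ge>N. ereal (real k) \<le> rat_val p (s m - s n)"
      using N by (intro exI[of _ N] allI impI order_trans[OF min.boundedI rat_val_diff[OF assms]]) auto
  qed
qed

lemma cauchy_val_cases:
  assumes "prime p" "s \<in> carrier (cauchy_ring p)" "s \<notin> null_ideal p"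
  shows "\<exists>k::int. eventually (\<lambda>n. rat_val p (s n) = ereal (of_int k)) sequentially"
proof -
  obtain k :: nat where k: "\<forall>N. \<exists>n\<ge>N. rat_val p (s n) < ereal (real k)"
    using assms(3) unfolding null_ideal_iff by (auto simp: not_le)
  obtain N where N: "\<forall>m\<ge>N. \<forall>n\<ge>N. ereal (real k) \<le> rat_val p (s m - s n)"
    using assms(2) cauchy_ring_iff by metis
  obtain m where m: "m \<ge> N" "rat_val p (s m) < ereal (real k)" using k by blast
  have "rat_val p (s n) = rat_val p (s m)" if n: "n \<ge> N" for n
  proof -
    have 1: "ereal (real k) \<le> rat_val p (s n - s m)" "ereal (real k) \<le> rat_val p (s m - s n)"
      using N n m by auto
    have "min (rat_val p (s n - s m)) (rat_val p (s m)) \<le> rat_val p (s n)"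
      using rat_val_add[OF assms(1), of "s n - s m" "s m"] by simp
    then have 2: "rat_val p (s m) \<le> rat_val p (s n)" using 1 m(2) by (auto simp: min_def split: if_splits)
    have "min (rat_val p (s m - s n)) (rat_val p (s n)) \<le> rat_val p (s m)"
      using rat_val_add[OF assms(1), of "s m - s n" "s n"] by simp
    then have "rat_val p (s n) \<le> rat_val p (s m)" using 1 m(2) by (auto simp: min_def split: if_splits)
    then show ?thesis using 2 by simp
  qed
  moreover obtain j :: int where "rat_val p (s m) = ereal (of_int j)"
    using rat_val_int[of p "s m"] m(2) by auto
  ultimately show ?thesis unfolding eventually_sequentially by metis
qed

lemma cauchy_bounded:
  assumes "prime p" "s \<in> carrier (cauchy_ring p)"
  shows "\<exists>K::nat. \<exists>N. \<forall>n\<ge>N. ereal (- real K) \<le> rat_val p (s n)"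
proof (cases "s \<in> null_ideal p")
  case True
  then obtain N where "\<forall>n\<ge>N. ereal (real 0) \<le> rat_val p (s n)" using null_ideal_iff by metis
  then show ?thesis by (intro exI[of _ 0] exI[of _ N]) simp
next
  case False
  obtain k :: int where "eventually (\<lambda>n. rat_val p (s n) = ereal (of_int k)) sequentially"
    using cauchy_val_cases[OF assms False] by blast
  then obtain N where N: "\<forall>n\<ge>N. rat_val p (s n) = ereal (of_int k)"
    unfolding eventually_sequentially by blast
  have "- real (nat \<bar>k\<bar>) \<le> of_int k" by simp
  then show ?thesis using N by (metis ereal_less_eq(3))
qed

lemma ereal_add_mono_k:
  "ereal (real (k + K)) \<le> x \<Longrightarrow> ereal (- real K) \<le> y \<Longrightarrow> ereal (real k) \<le> x + y"
  by (cases x; cases y) auto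

lemma null_mult:
  assumes "prime p" "s \<in> carrier (cauchy_ring p)" "t \<in> null_ideal p"
  shows "(\<lambda>n. s n * t n) \<in> null_ideal p"
  unfolding null_ideal_iff
proof
  fix k :: nat
  obtain K N where N: "\<forall>n\<ge>N. ereal (- real K) \<le> rat_val p (s n)"
    using cauchy_bounded[OF assms(1,2)] by blast
  obtain M where M: "\<forall>n\<ge>M. ereal (real (k + K)) \<le> rat_val p (t n)"
    using assms(3) null_ideal_iff by metis
  have "ereal (real k) \<le> rat_val p (s n * t n)" if "n \<ge> max N M" for n
    using ereal_add_mono_k[of k K "rat_val p (t n)" "rat_val p (s n)"] N M that
      rat_val_mult[OF assms(1), of "t n" "s n"] by (simp add: mult.commute)
  then show "\<exists>N. \<forall>n\<ge>N. ereal (real k) \<le> rat_val p (s n * t n)" by blast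
qed

lemma null_add:
  assumes "prime p" "s \<in> null_ideal p" "t \<in> null_ideal p"
  shows "(\<lambda>n. s n + t n) \<in> null_ideal p"
  unfolding null_ideal_iff
proof
  fix k :: nat
  obtain N where N: "\<forall>n\<ge>N. ereal (real k) \<le> rat_val p (s n)"
    using assms null_ideal_iff by metis
  obtain M where M: "\<forall>n\<ge>M. ereal (real k) \<le> rat_val p (t n)"
    using assms null_ideal_iff by metis
  have "ereal (real k) \<le> rat_val p (s n + t n)" if "n \<ge> max N M" for n
  proof (rule order_trans[OF min.boundedI rat_val_add[OF assms(1)]])
    show "ereal (real k) \<le> rat_val p (s n)" "ereal (real k) \<le> rat_val p (t n)"
      using N M that by auto
  qed
  then show "\<exists>N. \<forall>n\<ge>N. ereal (real k) \<le> rat_val p (s n + t n)" by blast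
qed

lemma null_minus: "s \<in> null_ideal p \<Longrightarrow> (\<lambda>n. - s n) \<in> null_ideal p"
  by (simp add: null_ideal_iff)

lemma cauchy_add:
  assumes "prime p" "s \<in> carrier (cauchy_ring p)" "t \<in> carrier (cauchy_ring p)"
  shows "(\<lambda>n. s n + t n) \<in> carrier (cauchy_ring p)"
  unfolding cauchy_ring_iff
proof
  fix k :: nat
  obtain N where N: "\<forall>m\<ge>N. \<forall>n\<ge>N. ereal (real k) \<le> rat_val p (s m - s n)"
    using assms cauchy_ring_iff by metis
  obtain M where M: "\<forall>m\<ge>M. \<forall>n\<ge>M. ereal (real k) \<le> rat_val p (t m - t n)"
    using assms cauchy_ring_iff by metis
  have "ereal (real k) \<le> rat_val p ((s m + t m) - (s n + t n))" if "m \<ge> max N M" "n \<ge> max N M" for m n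
  proof -
    have "min (rat_val p (s m - s n)) (rat_val p (t m - t n)) \<le> rat_val p ((s m + t m) - (s n + t n))"
      using rat_val_add[OF assms(1), of "s m - s n" "t m - t n"] by (simp add: algebra_simps)
    moreover have "ereal (real k) \<le> min (rat_val p (s m - s n)) (rat_val p (t m - t n))"
      using N M that by auto
    ultimately show ?thesis by (rule order_trans[rotated])
  qed
  then show "\<exists>N. \<forall>m\<ge>N. \<forall>n\<ge>N. ereal (real k) \<le> rat_val p (s m + t m - (s n + t n))" by blast
qed

lemma cauchy_minus:
  assumes "s \<in> carrier (cauchy_ring p)"
  shows "(\<lambda>n. - s n) \<in> carrier (cauchy_ring p)"
proof -
  have "rat_val p (- s m - - s n) = rat_val p (s m - s n)" for m n
    using rat_val_minus[of p "s m - s n"] by simp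
  then show ?thesis using assms unfolding cauchy_ring_iff by simp
qed

lemma cauchy_mult:
  assumes p: "prime p" and s: "s \<in> carrier (cauchy_ring p)" and t: "t \<in> carrier (cauchy_ring p)"
  shows "(\<lambda>n. s n * t n) \<in> carrier (cauchy_ring p)"
  unfolding cauchy_ring_iff
proof
  fix k :: nat
  obtain K N where N: "\<forall>n\<ge>N. ereal (- real K) \<le> rat_val p (s n)"
    using cauchy_bounded[OF p s] by blast
  obtain L M where M: "\<forall>n\<ge>M. ereal (- real L) \<le> rat_val p (t n)"
    using cauchy_bounded[OF p t] by blast
  obtain N' where N': "\<forall>m\<ge>N'. \<forall>n\<ge>N'. ereal (real (k + L)) \<le> rat_val p (s m - s n)"
    using s cauchy_ring_iff by metis
  obtain M' where M': "\<forall>m\<ge>M'. \<forall>n\<ge>M'. ereal (real (k + K)) \<le> rat_val p (t m - t n)"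
    using t cauchy_ring_iff by metis
  let ?N = "max (max N M) (max N' M')"
  have "ereal (real k) \<le> rat_val p (s m * t m - s n * t n)" if "m \<ge> ?N" "n \<ge> ?N" for m n
  proof -
    have 1: "ereal (real k) \<le> rat_val p ((s m - s n) * t m)"
      using N' M that by (auto simp: rat_val_mult[OF p] intro!: ereal_add_mono_k[of k L])
    have 2: "ereal (real k) \<le> rat_val p ((t m - t n) * s n)"
      using M' N that by (auto simp: rat_val_mult[OF p] intro!: ereal_add_mono_k[of k K])
    have "s m * t m - s n * t n = (s m - s n) * t m + (t m - t n) * s n" by (simp add: algebra_simps)
    then show ?thesis
      using order_trans[OF min.boundedI[OF 1 2] rat_val_add[OF p]] by simp
  qed
  then show "\<exists>N. \<forall>m\<ge>N. \<forall>n\<ge>N. ereal (real k) \<le> rat_val p (s m * t m - s n * t n)" by blast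
qed

lemma cauchy_const: "(\<lambda>n. c) \<in> carrier (cauchy_ring p)"
  by (simp add: cauchy_ring_iff)

lemma cring_cauchy_ring: assumes p: "prime p" shows "cring (cauchy_ring p)"
proof (rule cringI)
  show "abelian_group (cauchy_ring p)"
  proof (rule abelian_groupI)
    fix x assume "x \<in> carrier (cauchy_ring p)"
    then show "\<exists>y\<in>carrier (cauchy_ring p). y \<oplus>\<^bsub>cauchy_ring p\<^esub> x = \<zero>\<^bsub>cauchy_ring p\<^esub>"
      by (intro bexI[OF _ cauchy_minus]) auto
  qed (auto simp: cauchy_add[OF p] cauchy_const algebra_simps)
  show "Group.comm_monoid (cauchy_ring p)"
    by (rule Group.comm_monoidI) (auto simp: cauchy_mult[OF p] cauchy_const algebra_simps)
qed (auto simp: algebra_simps)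

lemma cauchy_a_inv:
  assumes p: "prime p" and s: "s \<in> carrier (cauchy_ring p)"
  shows "\<ominus>\<^bsub>cauchy_ring p\<^esub> s = (\<lambda>n. - s n)"
proof -
  interpret cring "cauchy_ring p" by (rule cring_cauchy_ring[OF p])
  show ?thesis
    by (rule sum_zero_eq_neg[symmetric]) (use s cauchy_minus[OF s] in auto)
qed

lemma ideal_null_ideal: assumes p: "prime p" shows "ideal (null_ideal p) (cauchy_ring p)"
proof (rule idealI)
  interpret cring "cauchy_ring p" by (rule cring_cauchy_ring[OF p])
  show "ring (cauchy_ring p)" by (rule ring_axioms)
  have sub: "null_ideal p \<subseteq> carrier (cauchy_ring p)" by (rule null_subset_cauchy[OF p])
  show "subgroup (null_ideal p) (add_monoid (cauchy_ring p))"
  proof (rule subgroup.intro)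
    fix x assume x: "x \<in> null_ideal p"
    have "inv\<^bsub>add_monoid (cauchy_ring p)\<^esub> x = \<ominus>\<^bsub>cauchy_ring p\<^esub> x" by (simp add: a_inv_def)
    then show "inv\<^bsub>add_monoid (cauchy_ring p)\<^esub> x \<in> null_ideal p"
      using cauchy_a_inv[OF p, of x] x sub null_minus by auto
  qed (use sub null_add[OF p] in \<open>auto simp: null_ideal_iff\<close>)
  show "x \<otimes>\<^bsub>cauchy_ring p\<^esub> a \<in> null_ideal p" "a \<otimes>\<^bsub>cauchy_ring p\<^esub> x \<in> null_ideal p"
    if "a \<in> null_ideal p" "x \<in> carrier (cauchy_ring p)" for a x
    using null_mult[OF p that(2,1)] by (simp_all add: mult.commute)
qed

lemma cring_Qp: assumes p: "prime p" shows "cring (Qp p)"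
  unfolding Qp_def by (rule ideal.quotient_is_cring[OF ideal_null_ideal[OF p] cring_cauchy_ring[OF p]])

abbreviation padic_class :: "nat \<Rightarrow> (nat \<Rightarrow> rat) \<Rightarrow> padic" where
  "padic_class p s \<equiv> null_ideal p +>\<^bsub>cauchy_ring p\<^esub> s"

lemma padic_class_iff: "t \<in> padic_class p s \<longleftrightarrow> (\<lambda>n. t n - s n) \<in> null_ideal p"
proof
  assume "t \<in> padic_class p s"
  then show "(\<lambda>n. t n - s n) \<in> null_ideal p" by (auto simp: a_r_coset_def')
next
  assume "(\<lambda>n. t n - s n) \<in> null_ideal p"
  then show "t \<in> padic_class p s"
    by (auto simp: a_r_coset_def' intro!: bexI[of _ "\<lambda>n. t n - s n"])
qed

lemma Qp_carrierE:
  assumes "x \<in> carrier (Qp p)"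
  obtains s where "s \<in> carrier (cauchy_ring p)" "x = padic_class p s"
  using assms by (auto simp: Qp_def FactRing_def A_RCOSETS_def')

lemma padic_class_carrier: "s \<in> carrier (cauchy_ring p) \<Longrightarrow> padic_class p s \<in> carrier (Qp p)"
  by (auto simp: Qp_def FactRing_def A_RCOSETS_def')

lemma padic_class_mult:
  assumes "prime p" "s \<in> carrier (cauchy_ring p)" "t \<in> carrier (cauchy_ring p)"
  shows "padic_class p s \<otimes>\<^bsub>Qp p\<^esub> padic_class p t = padic_class p (\<lambda>n. s n * t n)"
  using ideal.rcoset_mult_add[OF ideal_null_ideal[OF assms(1)] assms(2,3)]
  by (simp add: Qp_def FactRing_def)

lemma padic_class_add:
  assumes "prime p" "s \<in> carrier (cauchy_ring p)" "t \<in> carrier (cauchy_ring p)"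
  shows "padic_class p s \<oplus>\<^bsub>Qp p\<^esub> padic_class p t = padic_class p (\<lambda>n. s n + t n)"
  using ideal.a_rcos_sum[OF ideal_null_ideal[OF assms(1)] assms(2,3)]
  by (simp add: Qp_def FactRing_def)

lemma Qp_one: "\<one>\<^bsub>Qp p\<^esub> = padic_class p (\<lambda>n. 1)"
  by (simp add: Qp_def FactRing_def)

lemma Qp_zero: "\<zero>\<^bsub>Qp p\<^esub> = null_ideal p"
  by (simp add: Qp_def FactRing_def)

lemma Qp_zero': "\<zero>\<^bsub>Qp p\<^esub> = padic_class p (\<lambda>n. 0)"
  by (auto simp: Qp_zero padic_class_iff)

lemma tendsto_null_diff:
  assumes p: "prime p" and s: "s \<in> carrier (cauchy_ring p)" and t: "(\<lambda>n. t n - s n) \<in> null_ideal p"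
    and lim: "(\<lambda>n. rat_val p (s n)) \<longlonglongrightarrow> v"
  shows "(\<lambda>n. rat_val p (t n)) \<longlonglongrightarrow> v"
proof (cases "s \<in> null_ideal p")
  case True
  have "(\<lambda>n. (t n - s n) + s n) \<in> null_ideal p" by (rule null_add[OF p t True])
  then have "t \<in> null_ideal p" by simp
  then have t': "(\<lambda>n. rat_val p (t n)) \<longlonglongrightarrow> \<infinity>" by (simp add: null_ideal_iff_tendsto)
  have "v = \<infinity>" using True lim LIMSEQ_unique unfolding null_ideal_iff_tendsto by blast
  then show ?thesis using t' by simp
next
  case False
  obtain k :: int where k: "eventually (\<lambda>n. rat_val p (s n) = ereal (of_int k)) sequentially"
    using cauchy_val_cases[OF p s False] by blast
  have "eventually (\<lambda>n. ereal (of_int k) < rat_val p (t n - s n)) sequentially"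
    using t unfolding null_ideal_iff_tendsto tendsto_PInfty by blast
  then have "eventually (\<lambda>n. rat_val p (t n) = rat_val p (s n)) sequentially"
    using k
  proof eventually_elim
    case (elim n)
    have 1: "min (rat_val p (t n - s n)) (rat_val p (s n)) \<le> rat_val p (t n)"
      using rat_val_add[OF p, of "t n - s n" "s n"] by simp
    have 2: "min (rat_val p (t n)) (rat_val p (t n - s n)) \<le> rat_val p (s n)"
      using rat_val_diff[OF p, of "t n" "t n - s n"] by simp
    show ?case using 1 2 elim by (auto simp: min_def split: if_splits)
  qed
  then show ?thesis using lim by (simp add: tendsto_cong)
qed

lemma padic_val_tendsto:
  assumes p: "prime p" and s: "s \<in> carrier (cauchy_ring p)"
  shows "(\<lambda>n. rat_val p (s n)) \<longlonglongrightarrow> padic_val p (padic_class p s)"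
proof -
  obtain v where v: "(\<lambda>n. rat_val p (s n)) \<longlonglongrightarrow> v"
  proof (cases "s \<in> null_ideal p")
    case False
    then show ?thesis
      using cauchy_val_cases[OF p s False] that by (metis (mono_tags) tendsto_eventually)
  qed (use null_ideal_iff_tendsto that in blast)
  have all: "\<forall>t\<in>padic_class p s. (\<lambda>n. rat_val p (t n)) \<longlonglongrightarrow> v"
    using tendsto_null_diff[OF p s _ v] padic_class_iff by blast
  have self: "s \<in> padic_class p s" by (simp add: padic_class_iff null_ideal_iff)
  have "padic_val p (padic_class p s) = v"
    unfolding padic_val_def
  proof (rule the_equality)
    show "\<forall>t\<in>padic_class p s. (\<lambda>n. rat_val p (t n)) \<longlonglongrightarrow> v" by (rule all)
    show "w = v" if "\<forall>t\<in>padic_class p s. (\<lambda>n. rat_val p (t n)) \<longlonglongrightarrow> w" for w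
      using that self v LIMSEQ_unique by blast
  qed
  then show ?thesis using v by simp
qed

lemma padic_val_zero: assumes p: "prime p" shows "padic_val p \<zero>\<^bsub>Qp p\<^esub> = \<infinity>"
  using padic_val_tendsto[OF p cauchy_const[of 0]]
  by (simp add: Qp_zero' LIMSEQ_const_iff)

lemma padic_val_one: assumes p: "prime p" shows "padic_val p \<one>\<^bsub>Qp p\<^esub> = 0"
  using padic_val_tendsto[OF p cauchy_const[of 1]]
  by (simp add: Qp_one LIMSEQ_const_iff)

lemma padic_val_add:
  assumes p: "prime p" and x: "x \<in> carrier (Qp p)" and y: "y \<in> carrier (Qp p)"
  shows "min (padic_val p x) (padic_val p y) \<le> padic_val p (x \<oplus>\<^bsub>Qp p\<^esub> y)"
proof -
  obtain s where s: "s \<in> carrier (cauchy_ring p)" "x = padic_class p s" using x by (rule Qp_carrierE)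
  obtain t where t: "t \<in> carrier (cauchy_ring p)" "y = padic_class p t" using y by (rule Qp_carrierE)
  show ?thesis
    unfolding s t padic_class_add[OF p s(1) t(1)]
    by (rule LIMSEQ_le[OF tendsto_min[OF padic_val_tendsto[OF p s(1)] padic_val_tendsto[OF p t(1)]]
          padic_val_tendsto[OF p cauchy_add[OF p s(1) t(1)]]])
       (use rat_val_add[OF p] in blast)
qed

lemma padic_val_cases:
  assumes p: "prime p" and x: "x \<in> carrier (Qp p)" and nz: "x \<noteq> \<zero>\<^bsub>Qp p\<^esub>"
  shows "\<exists>k::int. padic_val p x = ereal (of_int k)"
proof -
  obtain s where s: "s \<in> carrier (cauchy_ring p)" "x = padic_class p s" using x by (rule Qp_carrierE)
  have "s \<notin> null_ideal p"
  proof
    assume sn: "s \<in> null_ideal p"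
    interpret I: ideal "null_ideal p" "cauchy_ring p" by (rule ideal_null_ideal[OF p])
    have "padic_class p s = null_ideal p" by (rule I.a_rcos_const[OF sn])
    then show False using nz s by (simp add: Qp_zero)
  qed
  then obtain k :: int where "eventually (\<lambda>n. rat_val p (s n) = ereal (of_int k)) sequentially"
    using cauchy_val_cases[OF p s(1)] by blast
  then have "(\<lambda>n. rat_val p (s n)) \<longlonglongrightarrow> ereal (of_int k)" by (rule tendsto_eventually)
  then have "padic_val p x = ereal (of_int k)"
    using padic_val_tendsto[OF p s(1)] s(2) LIMSEQ_unique by blast
  then show ?thesis by blast
qed

lemma padic_val_not_MInf:
  assumes p: "prime p" and x: "x \<in> carrier (Qp p)" shows "padic_val p x \<noteq> - \<infinity>"
  using padic_val_cases[OF p x] padic_val_zero[OF p] by (cases "x = \<zero>\<^bsub>Qp p\<^esub>") auto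

lemma padic_val_mult:
  assumes p: "prime p" and x: "x \<in> carrier (Qp p)" and y: "y \<in> carrier (Qp p)"
  shows "padic_val p (x \<otimes>\<^bsub>Qp p\<^esub> y) = padic_val p x + padic_val p y"
proof -
  obtain s where s: "s \<in> carrier (cauchy_ring p)" "x = padic_class p s" using x by (rule Qp_carrierE)
  obtain t where t: "t \<in> carrier (cauchy_ring p)" "y = padic_class p t" using y by (rule Qp_carrierE)
  have ne: "padic_val p x \<noteq> - \<infinity>" "padic_val p y \<noteq> - \<infinity>"
    using padic_val_not_MInf[OF p] x y by auto
  have 1: "(\<lambda>n. rat_val p (s n) + rat_val p (t n)) \<longlonglongrightarrow> padic_val p x + padic_val p y"
    using ne by (intro tendsto_add_ereal_general padic_val_tendsto[OF p s(1), folded s(2)]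
        padic_val_tendsto[OF p t(1), folded t(2)]) auto
  have 2: "x \<otimes>\<^bsub>Qp p\<^esub> y = padic_class p (\<lambda>n. s n * t n)"
    using padic_class_mult[OF p s(1) t(1)] s(2) t(2) by simp
  have "(\<lambda>n. rat_val p (s n) + rat_val p (t n)) \<longlonglongrightarrow> padic_val p (x \<otimes>\<^bsub>Qp p\<^esub> y)"
    using padic_val_tendsto[OF p cauchy_mult[OF p s(1) t(1)]] unfolding 2 by (simp add: rat_val_mult[OF p])
  then show ?thesis using 1 by (rule LIMSEQ_unique)
qed

lemma padic_val_uminus:
  assumes p: "prime p" and x: "x \<in> carrier (Qp p)"
  shows "padic_val p (\<ominus>\<^bsub>Qp p\<^esub> x) = padic_val p x"
proof -
  interpret cring "Qp p" by (rule cring_Qp[OF p])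
  have "ereal 0 = padic_val p (\<ominus>\<^bsub>Qp p\<^esub> \<one>\<^bsub>Qp p\<^esub>) + padic_val p (\<ominus>\<^bsub>Qp p\<^esub> \<one>\<^bsub>Qp p\<^esub>)"
    using padic_val_mult[OF p, of "\<ominus>\<^bsub>Qp p\<^esub> \<one>\<^bsub>Qp p\<^esub>" "\<ominus>\<^bsub>Qp p\<^esub> \<one>\<^bsub>Qp p\<^esub>"] padic_val_one[OF p]
    by (simp add: l_minus zero_ereal_def)
  then have v: "padic_val p (\<ominus>\<^bsub>Qp p\<^esub> \<one>\<^bsub>Qp p\<^esub>) = 0"
    by (cases "padic_val p (\<ominus>\<^bsub>Qp p\<^esub> \<one>\<^bsub>Qp p\<^esub>)") auto
  have "\<ominus>\<^bsub>Qp p\<^esub> x = (\<ominus>\<^bsub>Qp p\<^esub> \<one>\<^bsub>Qp p\<^esub>) \<otimes>\<^bsub>Qp p\<^esub> x"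
    using x by (simp add: l_minus)
  then show ?thesis using padic_val_mult[OF p _ x, of "\<ominus>\<^bsub>Qp p\<^esub> \<one>\<^bsub>Qp p\<^esub>"] v by simp
qed

lemma Metric_space_padic:
  assumes p: "prime p" shows "Metric_space (carrier (Qp p)) (padic_dist p)"
proof
  interpret cring "Qp p" by (rule cring_Qp[OF p])
  have p1: "real p > 1" using prime_gt_1_nat[OF p] by simp
  show "0 \<le> padic_dist p x y" for x y by (simp add: padic_dist_def)
  show "padic_dist p x y = padic_dist p y x" for x y
  proof (cases "x \<in> carrier (Qp p) \<and> y \<in> carrier (Qp p)")
    case True
    then have "x \<ominus>\<^bsub>Qp p\<^esub> y = \<ominus>\<^bsub>Qp p\<^esub> (y \<ominus>\<^bsub>Qp p\<^esub> x)"
      by (simp add: a_minus_def minus_add a_comm)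
    then show ?thesis using padic_val_uminus[OF p, of "y \<ominus>\<^bsub>Qp p\<^esub> x"] True
      by (auto simp: padic_dist_def)
  qed (auto simp: padic_dist_def)
  show "padic_dist p x y = 0 \<longleftrightarrow> x = y"
    if "x \<in> carrier (Qp p)" "y \<in> carrier (Qp p)" for x y
    using p1 that by (simp add: padic_dist_def)
  show "padic_dist p x z \<le> padic_dist p x y + padic_dist p y z"
    if x: "x \<in> carrier (Qp p)" and y: "y \<in> carrier (Qp p)" and z: "z \<in> carrier (Qp p)" for x y z
  proof (cases "x = y \<or> y = z \<or> x = z")
    case True
    then show ?thesis by (auto simp: padic_dist_def)
  next
    case False
    have diff_nz: "u \<ominus>\<^bsub>Qp p\<^esub> v \<noteq> \<zero>\<^bsub>Qp p\<^esub>"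
      if u: "u \<in> carrier (Qp p)" and v: "v \<in> carrier (Qp p)" and "u \<noteq> v" for u v
    proof
      assume "u \<ominus>\<^bsub>Qp p\<^esub> v = \<zero>\<^bsub>Qp p\<^esub>"
      then have "u = \<ominus>\<^bsub>Qp p\<^esub> (\<ominus>\<^bsub>Qp p\<^esub> v)"
        using u v by (intro sum_zero_eq_neg) (auto simp: a_minus_def)
      then show False using that by simp
    qed
    then have nz: "x \<ominus>\<^bsub>Qp p\<^esub> y \<noteq> \<zero>\<^bsub>Qp p\<^esub>" "y \<ominus>\<^bsub>Qp p\<^esub> z \<noteq> \<zero>\<^bsub>Qp p\<^esub>" "x \<ominus>\<^bsub>Qp p\<^esub> z \<noteq> \<zero>\<^bsub>Qp p\<^esub>"
      using x y z False by blast+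
    obtain i j k :: int where ijk: "padic_val p (x \<ominus>\<^bsub>Qp p\<^esub> y) = ereal i" "padic_val p (y \<ominus>\<^bsub>Qp p\<^esub> z) = ereal j"
        "padic_val p (x \<ominus>\<^bsub>Qp p\<^esub> z) = ereal k"
      using padic_val_cases[OF p _ nz(1)] padic_val_cases[OF p _ nz(2)] padic_val_cases[OF p _ nz(3)] x y z
      by auto
    have "x \<ominus>\<^bsub>Qp p\<^esub> z = (x \<ominus>\<^bsub>Qp p\<^esub> y) \<oplus>\<^bsub>Qp p\<^esub> (y \<ominus>\<^bsub>Qp p\<^esub> z)"
      using x y z by (simp add: a_minus_def a_assoc r_neg1)
    then have "min i j \<le> k"
      using padic_val_add[OF p, of "x \<ominus>\<^bsub>Qp p\<^esub> y" "y \<ominus>\<^bsub>Qp p\<^esub> z"] ijk x y z by (auto simp: min_def split: if_splits)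
    then have "real p powr (- real_of_int k) \<le> max (real p powr (- real_of_int i)) (real p powr (- real_of_int j))"
      using p1 by (auto simp: min_def max_def split: if_splits)
    also have "\<dots> \<le> real p powr (- real_of_int i) + real p powr (- real_of_int j)" by simp
    finally show ?thesis using False ijk x y z by (simp add: padic_dist_def)
  qed
qed

lemma Zp_carrier_iff: "x \<in> carrier (Zp p) \<longleftrightarrow> x \<in> carrier (Qp p) \<and> 0 \<le> padic_val p x"
  by (simp add: Zp_def)

lemma topspace_Zp: "prime p \<Longrightarrow> topspace (Zp_topology p) = carrier (Zp p)"
  by (auto simp: Zp_topology_def Qp_topology_def Zp_carrier_iff
      Metric_space.topspace_mtopology[OF Metric_space_padic])

lemma Zp_closed:
  assumes p: "prime p"
  shows "\<zero>\<^bsub>Qp p\<^esub> \<in> carrier (Zp p)" "\<one>\<^bsub>Qp p\<^esub> \<in> carrier (Zp p)"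
    "\<And>x y. x \<in> carrier (Zp p) \<Longrightarrow> y \<in> carrier (Zp p) \<Longrightarrow> x \<oplus>\<^bsub>Qp p\<^esub> y \<in> carrier (Zp p)"
    "\<And>x y. x \<in> carrier (Zp p) \<Longrightarrow> y \<in> carrier (Zp p) \<Longrightarrow> x \<otimes>\<^bsub>Qp p\<^esub> y \<in> carrier (Zp p)"
    "\<And>x. x \<in> carrier (Zp p) \<Longrightarrow> \<ominus>\<^bsub>Qp p\<^esub> x \<in> carrier (Zp p)"
proof -
  interpret cring "Qp p" by (rule cring_Qp[OF p])
  show "\<zero>\<^bsub>Qp p\<^esub> \<in> carrier (Zp p)" "\<one>\<^bsub>Qp p\<^esub> \<in> carrier (Zp p)"
    by (simp_all add: Zp_carrier_iff padic_val_zero[OF p] padic_val_one[OF p])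
  show "x \<oplus>\<^bsub>Qp p\<^esub> y \<in> carrier (Zp p)" if "x \<in> carrier (Zp p)" "y \<in> carrier (Zp p)" for x y
    using that padic_val_add[OF p, of x y] unfolding Zp_carrier_iff
    by (auto simp: min_def split: if_splits)
  show "x \<otimes>\<^bsub>Qp p\<^esub> y \<in> carrier (Zp p)" if "x \<in> carrier (Zp p)" "y \<in> carrier (Zp p)" for x y
    using that padic_val_mult[OF p, of x y] unfolding Zp_carrier_iff by auto
  show "\<ominus>\<^bsub>Qp p\<^esub> x \<in> carrier (Zp p)" if "x \<in> carrier (Zp p)" for x
    using that padic_val_uminus[OF p, of x] unfolding Zp_carrier_iff by auto
qed


section \<open>Finite adeles\<close>

abbreviation primes :: "nat set" where
  "primes \<equiv> {p. prime p}"

definition adele_set :: "(nat \<Rightarrow> padic) set" where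
  "adele_set =
     {x \<in> \<Pi>\<^sub>E p\<in>primes. carrier (Qp p). finite {p \<in> primes. x p \<notin> carrier (Zp p)}}"

lemma adele_setI:
  assumes "\<And>p. prime p \<Longrightarrow> f p \<in> carrier (Qp p)"
    and "\<And>p. prime p \<Longrightarrow> x p \<in> carrier (Zp p) \<Longrightarrow> y p \<in> carrier (Zp p) \<Longrightarrow> f p \<in> carrier (Zp p)"
    and "x \<in> adele_set" "y \<in> adele_set"
  shows "(\<lambda>p\<in>primes. f p) \<in> adele_set"
proof -
  have "finite ({p \<in> primes. x p \<notin> carrier (Zp p)} \<union> {p \<in> primes. y p \<notin> carrier (Zp p)})"
    using assms(3,4) by (simp add: adele_set_def)
  then have "finite {p \<in> primes. f p \<notin> carrier (Zp p)}"
    by (rule finite_subset[rotated]) (use assms(2) in auto)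
  moreover have "{p \<in> primes. (\<lambda>p\<in>primes. f p) p \<notin> carrier (Zp p)} = {p \<in> primes. f p \<notin> carrier (Zp p)}"
    by auto
  ultimately show ?thesis
    using assms(1) by (simp add: adele_set_def)
qed

lemma adele_set_carrier: "x \<in> adele_set \<Longrightarrow> prime p \<Longrightarrow> x p \<in> carrier (Qp p)"
  by (auto simp: adele_set_def)

lemma zero_in_adele_set: "(\<lambda>p\<in>primes. \<zero>\<^bsub>Qp p\<^esub>) \<in> adele_set"
  by (auto simp: adele_set_def Zp_closed cring.cring_simprules(2)[OF cring_Qp] intro!: finite_subset[of _ "{}"])

typedef adele = adele_set
  using zero_in_adele_set by blast

setup_lifting type_definition_adele

lift_definition component :: "nat \<Rightarrow> adele \<Rightarrow> padic" is "\<lambda>p x. x p" .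

lemma component_carrier: "prime p \<Longrightarrow> component p x \<in> carrier (Qp p)"
  by transfer (rule adele_set_carrier)

lemma finite_component: "finite {p \<in> primes. component p x \<notin> carrier (Zp p)}"
  by transfer (simp add: adele_set_def)

lemma adele_eqI: "(\<And>p. prime p \<Longrightarrow> component p x = component p y) \<Longrightarrow> x = y"
  by transfer (auto simp: adele_set_def intro: PiE_ext)

instantiation adele :: comm_ring_1
begin

lift_definition zero_adele :: adele is "\<lambda>p\<in>primes. \<zero>\<^bsub>Qp p\<^esub>"
  by (rule zero_in_adele_set)

lift_definition one_adele :: adele is "\<lambda>p\<in>primes. \<one>\<^bsub>Qp p\<^esub>"
  by (rule adele_setI[OF _ _ zero_in_adele_set zero_in_adele_set])
     (simp_all add: Zp_closed cring.cring_simprules(6)[OF cring_Qp])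

lift_definition plus_adele :: "adele \<Rightarrow> adele \<Rightarrow> adele" is "\<lambda>x y. \<lambda>p\<in>primes. x p \<oplus>\<^bsub>Qp p\<^esub> y p"
  subgoal for x y
    by (rule adele_setI[of _ x y])
       (simp_all add: Zp_closed adele_set_carrier cring.cring_simprules(1)[OF cring_Qp])
  done

lift_definition times_adele :: "adele \<Rightarrow> adele \<Rightarrow> adele" is "\<lambda>x y. \<lambda>p\<in>primes. x p \<otimes>\<^bsub>Qp p\<^esub> y p"
  subgoal for x y
    by (rule adele_setI[of _ x y])
       (simp_all add: Zp_closed adele_set_carrier cring.cring_simprules(5)[OF cring_Qp])
  done

lift_definition uminus_adele :: "adele \<Rightarrow> adele" is "\<lambda>x. \<lambda>p\<in>primes. \<ominus>\<^bsub>Qp p\<^esub> x p"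
  subgoal for x
    by (rule adele_setI[of _ x x])
       (simp_all add: Zp_closed adele_set_carrier cring.cring_simprules(3)[OF cring_Qp])
  done

definition minus_adele :: "adele \<Rightarrow> adele \<Rightarrow> adele" where
  "minus_adele x y = x + - y"

lemma component_simps:
  assumes "prime p"
  shows "component p 0 = \<zero>\<^bsub>Qp p\<^esub>" "component p 1 = \<one>\<^bsub>Qp p\<^esub>"
    "component p (x + y) = component p x \<oplus>\<^bsub>Qp p\<^esub> component p y"
    "component p (x * y) = component p x \<otimes>\<^bsub>Qp p\<^esub> component p y"
    "component p (- x) = \<ominus>\<^bsub>Qp p\<^esub> component p x"
  using assms by (transfer; simp)+

instance
proof
  fix a b c :: adele
  note cr = cring.cring_simprules[OF cring_Qp]
  note [simp] = component_simps component_carrier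
  show "a * b * c = a * (b * c)"
    by (rule adele_eqI) (simp add: cr(11))
  show "a * b = b * a"
    by (rule adele_eqI) (simp add: cr(14))
  show "1 * a = a"
    by (rule adele_eqI) (simp add: cr(12))
  show "a + b + c = a + (b + c)"
    by (rule adele_eqI) (simp add: cr(7))
  show "a + b = b + a"
    by (rule adele_eqI) (simp add: cr(10))
  show "0 + a = a"
    by (rule adele_eqI) (simp add: cr(8))
  show "- a + a = 0"
    by (rule adele_eqI) (simp add: cr(9))
  show "a - b = a + - b"
    by (rule minus_adele_def)
  show "(a + b) * c = a * c + b * c"
    by (rule adele_eqI) (simp add: cr(13))
  show "(0::adele) \<noteq> 1"
  proof
    assume "(0::adele) = 1"
    then have "component 2 0 = component 2 1" by simp
    then have "padic_val 2 \<zero>\<^bsub>Qp 2\<^esub> = padic_val 2 \<one>\<^bsub>Qp 2\<^esub>" by simp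
    then show False by (simp add: padic_val_zero padic_val_one)
  qed
qed

end

lemma component_diff:
  "prime p \<Longrightarrow> component p (x - y) = component p x \<ominus>\<^bsub>Qp p\<^esub> component p y"
  unfolding minus_adele_def a_minus_def by (simp only: component_simps)

text \<open>Inverse in the ring of finite adeles, meaningful for units.\<close>

definition adele_inv :: "adele \<Rightarrow> adele" where
  "adele_inv x = (THE y. x * y = 1)"

typedef zhat = "{x :: adele. \<forall>p. prime p \<longrightarrow> component p x \<in> carrier (Zp p)}"
  morphisms of_zhat Abs_zhat
  by (rule exI[of _ 0]) (simp add: component_simps Zp_closed)

setup_lifting type_definition_zhat

instantiation zhat :: comm_ring_1
begin

lift_definition zero_zhat :: zhat is 0
  by (simp add: component_simps Zp_closed)

lift_definition one_zhat :: zhat is 1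
  by (simp add: component_simps Zp_closed)

lift_definition plus_zhat :: "zhat \<Rightarrow> zhat \<Rightarrow> zhat" is "(+)"
  by (simp add: component_simps Zp_closed)

lift_definition times_zhat :: "zhat \<Rightarrow> zhat \<Rightarrow> zhat" is "(*)"
  by (simp add: component_simps Zp_closed)

lift_definition uminus_zhat :: "zhat \<Rightarrow> zhat" is "uminus"
  by (simp add: component_simps Zp_closed)

lift_definition minus_zhat :: "zhat \<Rightarrow> zhat \<Rightarrow> zhat" is "(-)"
  unfolding minus_adele_def by (simp only: component_simps Zp_closed)

instance
  by standard (transfer; simp add: algebra_simps)+

end

lemma of_zhat_simps [simp]:
  "of_zhat 0 = 0" "of_zhat 1 = 1" "of_zhat (x + y) = of_zhat x + of_zhat y"
  "of_zhat (x * y) = of_zhat x * of_zhat y" "of_zhat (- x) = - of_zhat x"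
  "of_zhat (x - y) = of_zhat x - of_zhat y"
  by (transfer; simp)+

definition zhat_of :: "(nat \<Rightarrow> padic) \<Rightarrow> zhat" where
  "zhat_of x = Abs_zhat (Abs_adele (\<lambda>p\<in>primes. x p))"

lemma component_zhat_of:
  assumes "\<And>p. prime p \<Longrightarrow> x p \<in> carrier (Zp p)" and p: "prime p"
  shows "component p (of_zhat (zhat_of x)) = x p"
proof -
  have 1: "(\<lambda>p\<in>primes. x p) \<in> adele_set"
    by (rule adele_setI[OF _ _ zero_in_adele_set zero_in_adele_set])
       (use assms(1) in \<open>auto simp: Zp_carrier_iff\<close>)
  have 2: "component q (Abs_adele (\<lambda>p\<in>primes. x p)) = x q" if "prime q" for q
    using Abs_adele_inverse[OF 1] that by (simp add: component.rep_eq)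
  have "of_zhat (zhat_of x) = Abs_adele (\<lambda>p\<in>primes. x p)"
    unfolding zhat_of_def by (rule Abs_zhat_inverse) (use 2 assms(1) in simp)
  then show ?thesis using 2 p by simp
qed

instantiation zhat :: topological_space
begin

definition open_zhat :: "zhat set \<Rightarrow> bool" where
  "open_zhat U \<longleftrightarrow>
     openin (product_topology Zp_topology primes) ((\<lambda>x. \<lambda>p\<in>primes. component p (of_zhat x)) ` U)"

instance
proof
  let ?f = "\<lambda>x. \<lambda>p\<in>primes. component p (of_zhat x)"
  have inj: "inj ?f"
  proof (rule injI)
    fix x y assume eq: "?f x = ?f y"
    have "component p (of_zhat x) = component p (of_zhat y)" if "prime p" for p
      using fun_cong[OF eq, of p] that by simp
    then have "of_zhat x = of_zhat y" by (rule adele_eqI)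
    then show "x = y" by (simp add: of_zhat_inject)
  qed
  have "topspace (product_topology Zp_topology primes) = (\<Pi>\<^sub>E p\<in>primes. carrier (Zp p))"
    unfolding topspace_product_topology by (rule PiE_cong) (simp add: topspace_Zp)
  also have "\<dots> = range ?f"
  proof (intro equalityI subsetI)
    fix x assume x: "x \<in> (\<Pi>\<^sub>E p\<in>primes. carrier (Zp p))"
    have "component p (of_zhat (zhat_of x)) = x p" if "prime p" for p
      by (rule component_zhat_of) (use x that in auto)
    then have "?f (zhat_of x) = x"
      using x by (auto simp: fun_eq_iff PiE_def extensional_def)
    then show "x \<in> range ?f" by (rule range_eqI[OF sym])
  qed (use of_zhat in auto)
  finally show "open (UNIV :: zhat set)"
    using openin_topspace[of "product_topology Zp_topology primes"] unfolding open_zhat_def by simp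
  show "open (S \<inter> T)" if "open S" "open T" for S T :: "zhat set"
    using that unfolding open_zhat_def image_Int[OF inj] by (rule openin_Int)
  show "open (\<Union>K)" if "\<forall>S\<in>K. open S" for K :: "zhat set set"
    using that unfolding open_zhat_def image_Union by (intro openin_Union) auto
qed

end

abbreviation zhat_val :: "nat \<Rightarrow> zhat \<Rightarrow> ereal" where
  "zhat_val p x \<equiv> padic_val p (component p (of_zhat x))"

section \<open>Integer-valued polynomials and adelic orderings\<close>

definition zhat_scale :: "zhat \<Rightarrow> adele poly \<Rightarrow> adele poly" where
  "zhat_scale c f = smult (of_zhat c) f"

interpretation zhat_module: module zhat_scale
  by standard (simp_all add: zhat_scale_def smult_add_right smult_add_left)

definition zhat_prod :: "(nat \<Rightarrow> padic set) \<Rightarrow> zhat set" where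
  "zhat_prod E = {x. \<forall>p. prime p \<longrightarrow> component p (of_zhat x) \<in> E p}"

text \<open>
  Evaluating a polynomial over the finite adeles at a finite adele is the same as evaluating all of
  its components.
\<close>

definition int_valued :: "zhat set \<Rightarrow> adele poly set" where
  "int_valued E = {g. \<forall>x\<in>E. poly g (of_zhat x) \<in> range of_zhat}"

text \<open>The infimum is a minimum, as it is attained at the point \<open>\<alpha> n\<close> of \<open>E\<close>.\<close>

definition adelic_ordering :: "zhat set \<Rightarrow> (nat \<Rightarrow> zhat) \<Rightarrow> bool" where
  "adelic_ordering E \<alpha> \<longleftrightarrow>
     (\<forall>n. \<alpha> n \<in> E) \<and>
     (\<forall>p n. prime p \<and> n \<ge> 1 \<longrightarrow>
        zhat_val p (\<Prod>k<n. \<alpha> n - \<alpha> k) = (INF y\<in>E. zhat_val p (\<Prod>k<n. y - \<alpha> k))) \<and>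
     (\<forall>n\<ge>1. finite {p. prime p \<and> zhat_val p (\<Prod>k<n. \<alpha> n - \<alpha> k) \<noteq> 0})"

definition ordering_poly :: "(nat \<Rightarrow> zhat) \<Rightarrow> nat \<Rightarrow> adele poly" where
  "ordering_poly \<alpha> n =
     (\<Prod>k<n. smult (adele_inv (of_zhat (\<alpha> n) - of_zhat (\<alpha> k))) [:- of_zhat (\<alpha> k), 1:])"

definition zhat_basis :: "adele poly set \<Rightarrow> (nat \<Rightarrow> adele poly) \<Rightarrow> bool" where
  "zhat_basis M g \<longleftrightarrow>
     inj g \<and> zhat_module.independent (range g) \<and> zhat_module.span (range g) = M"

definition continuous_family :: "(nat \<Rightarrow> padic set) \<Rightarrow> (nat \<Rightarrow> padic \<Rightarrow> padic) \<Rightarrow> bool" where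
  "continuous_family E \<phi> \<longleftrightarrow>
     (\<forall>p. prime p \<longrightarrow> continuous_map (subtopology (Zp_topology p) (E p)) (Zp_topology p) (\<phi> p))"

definition family_fun :: "(nat \<Rightarrow> padic \<Rightarrow> padic) \<Rightarrow> zhat \<Rightarrow> zhat" where
  "family_fun \<phi> x = zhat_of (\<lambda>p. \<phi> p (component p (of_zhat x)))"

text \<open>
  Uniform convergence on \<open>E\<close>, for the uniform structure of the topological group of profinite
  integers: the remainders lie eventually, uniformly in the argument, in any given neighbourhood of
  zero.
\<close>

definition uniform_series ::
  "zhat set \<Rightarrow> (nat \<Rightarrow> adele poly) \<Rightarrow> (nat \<Rightarrow> zhat) \<Rightarrow> (zhat \<Rightarrow> zhat) \<Rightarrow> bool" where
  "uniform_series E g c f \<longleftrightarrow>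
     (\<forall>U. open U \<and> 0 \<in> U \<longrightarrow>
        (\<forall>\<^sub>F N in sequentially. \<forall>x\<in>E.
           of_zhat (f x) - (\<Sum>n<N. of_zhat (c n) * poly (g n) (of_zhat x)) \<in> of_zhat ` U))"

definition series_expansion ::
  "zhat set \<Rightarrow> (nat \<Rightarrow> adele poly) \<Rightarrow> (zhat \<Rightarrow> zhat) \<Rightarrow> (nat \<Rightarrow> zhat) \<Rightarrow> bool" where
  "series_expansion E g f c \<longleftrightarrow> c \<longlonglongrightarrow> 0 \<and> uniform_series E g c f"

end

theory Submission
  imports Defs "HOL-Number_Theory.Cong"
begin

text \<open>
  Valuations of a profinite integer are natural numbers or infinite, so at every prime the product
  \<open>\<Prod>k<n. y - \<alpha> k\<close> attains its least valuation on \<open>E p\<close>; gluing the minimisers gives \<open>\<alpha> n\<close>. The minimum is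
  finite as \<open>E p\<close> is infinite, and zero as soon as \<open>E p\<close> meets more than \<open>n\<close> residue classes, so the
  denominators are units of the finite adeles and the \<open>g n\<close> are integer valued on \<open>E\<close>. Since
  \<open>g n\<close> is \<open>1\<close> at \<open>\<alpha> n\<close> and \<open>0\<close> at the earlier points, the coefficients of an expansion are determined by
  the values at the \<open>\<alpha> n\<close> through a triangular recursion, which preserves lower bounds of the
  valuation at each prime. Applied to a polynomial this gives the basis. For a continuous function
  \<open>f\<close> it remains to see that \<open>f\<close> is congruent modulo \<open>p ^ k\<close> to a polynomial on \<open>E p\<close>: then, by the
  recursion, the coefficients of \<open>f\<close> and of that polynomial are congruent modulo \<open>p ^ k\<close>, so almost all
  coefficients of \<open>f\<close> are divisible by \<open>p ^ k\<close>. No completeness argument is needed.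

  By compactness \<open>f\<close> is constant modulo \<open>p ^ k\<close> on balls of some radius \<open>p ^ -m\<close>, so only indicators of
  balls have to be approximated. With \<open>q = p ^ m\<close>, the polynomial \<open>\<Prod>j=1..<q. 1 - t / j\<close> is
  congruent modulo \<open>p\<close> to the indicator of \<open>q\<close> dividing \<open>t\<close>, because \<open>t\<close> times it equals up to sign
  \<open>q\<close> times the binomial coefficient of \<open>t\<close> over \<open>q\<close>.
\<close>

section \<open>Inverses and density of the natural numbers\<close>

text \<open>A Cauchy sequence outside the null ideal has eventually constant finite valuation, so
  its termwise inverses exist far out and are again Cauchy.\<close>

lemma padic_inverse:
  assumes p: "prime p" and x: "x \<in> carrier (Qp p)" and nz: "x \<noteq> \<zero>\<^bsub>Qp p\<^esub>"
  shows "\<exists>y\<in>carrier (Qp p). x \<otimes>\<^bsub>Qp p\<^esub> y = \<one>\<^bsub>Qp p\<^esub>"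
proof -
  interpret I: ideal "null_ideal p" "cauchy_ring p" by (rule ideal_null_ideal[OF p])
  obtain s where s: "s \<in> carrier (cauchy_ring p)" "x = padic_class p s" using x by (rule Qp_carrierE)
  have "s \<notin> null_ideal p" using nz s(2) I.a_rcos_const by (auto simp: Qp_zero)
  then obtain k :: int where "eventually (\<lambda>n. rat_val p (s n) = ereal (of_int k)) sequentially"
    using cauchy_val_cases[OF p s(1)] by blast
  then obtain N where N: "\<And>n. n \<ge> N \<Longrightarrow> rat_val p (s n) = ereal (of_int k)"
    unfolding eventually_sequentially by blast
  have s0: "s n \<noteq> 0" if "n \<ge> N" for n using N[OF that] by auto
  define t where "t = (\<lambda>n. inverse (s n))"
  have t: "t \<in> carrier (cauchy_ring p)"
    unfolding cauchy_ring_iff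
  proof
    fix j :: nat
    \<comment> \<open>Far out, a difference of inverses is a difference of terms divided by a
      product of valuation \<open>2 * k\<close>; hence the extra precision.\<close>
    obtain M where M: "\<forall>m\<ge>M. \<forall>n\<ge>M. ereal (real (j + nat (2 * \<bar>k\<bar>))) \<le> rat_val p (s m - s n)"
      using s(1) cauchy_ring_iff by metis
    have "ereal (real j) \<le> rat_val p (t m - t n)" if mn: "m \<ge> max M N" "n \<ge> max M N" for m n
    proof -
      have "(t m - t n) * (s m * s n) = s n - s m"
        using s0 mn by (simp add: t_def field_simps)
      then have "rat_val p (t m - t n) + (ereal (of_int k) + ereal (of_int k)) = rat_val p (s n - s m)"
        using N mn by (metis rat_val_mult[OF p] max.bounded_iff)
      moreover have "ereal (real (j + nat (2 * \<bar>k\<bar>))) \<le> rat_val p (s n - s m)" using M mn by simp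
      ultimately have "ereal (real (j + nat (2 * \<bar>k\<bar>))) \<le> rat_val p (t m - t n) + ereal (of_int (2 * k))"
        by simp
      moreover have "real_of_int (2 * k) \<le> real (nat (2 * \<bar>k\<bar>))" by linarith
      ultimately show ?thesis
        by (cases "rat_val p (t m - t n)") (auto simp del: of_int_mult)
    qed
    then show "\<exists>N. \<forall>m\<ge>N. \<forall>n\<ge>N. ereal (real j) \<le> rat_val p (t m - t n)" by blast
  qed
  have "(\<lambda>n. s n * t n - 1) \<in> null_ideal p"
    unfolding null_ideal_iff using s0 by (auto simp: t_def intro!: exI[of _ N])
  then have "(\<lambda>n. s n * t n) \<in> padic_class p (\<lambda>n. 1)" by (simp add: padic_class_iff)
  then have "padic_class p (\<lambda>n. s n * t n) = padic_class p (\<lambda>n. 1)"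
    using I.a_repr_independence'[OF _ cauchy_const[of 1]] by metis
  then have "x \<otimes>\<^bsub>Qp p\<^esub> padic_class p t = \<one>\<^bsub>Qp p\<^esub>"
    unfolding s(2) padic_class_mult[OF p s(1) t] by (simp add: Qp_one)
  then show ?thesis using padic_class_carrier[OF t] by blast
qed

text \<open>In lowest terms a \<open>p\<close>-integral fraction has denominator prime to
  \<open>p\<close>; inverting it modulo \<open>p ^ m\<close> turns the fraction into a
  residue.\<close>

lemma rat_near_nat:
  assumes p: "prime p" and r: "0 \<le> rat_val p r"
  shows "\<exists>n::nat. ereal (real m) \<le> rat_val p (r - of_nat n)"
proof -
  obtain a b where ab: "quotient_of r = (a, b)" by fastforce
  have b: "b > 0" "coprime a b" "r = of_int a / of_int b"
    using quotient_of_denom_pos[OF ab] quotient_of_coprime[OF ab] quotient_of_div[OF ab] by auto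
  have "\<not> int p dvd b"
  proof
    assume pb: "int p dvd b"
    then have "\<not> int p dvd a"
      using b(2) p by (metis coprime_def not_prime_unit prime_nat_int_transfer)
    then have "multiplicity (int p) a = 0" "a \<noteq> 0"
      by (auto simp: not_dvd_imp_multiplicity_0)
    moreover have "multiplicity (int p) b > 0"
      using pb b(1) p by (intro multiplicity_gt_zero_iff[THEN iffD2]) auto
    ultimately show False using r b(1) by (simp add: b(3) rat_val_frac[OF p])
  qed
  then have cop: "coprime b (int p ^ m)"
    using p prime_imp_coprime[of "int p" b] by (simp add: coprime_commute)
  then obtain c where c: "[b * c = 1] (mod int p ^ m)" using cong_solve_coprime_int by blast
  define n where "n = nat (a * c mod int p ^ m)"
  have "int p ^ m > 0" using prime_gt_0_nat[OF p] by simp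
  then have n: "int n = a * c mod int p ^ m" by (simp add: n_def)
  have "[a - b * int n = a - b * (a * c)] (mod int p ^ m)"
    unfolding n by (intro cong_diff cong_mult cong_refl) (simp add: cong_def)
  moreover have "[a - a * (b * c) = a - a * 1] (mod int p ^ m)"
    by (intro cong_diff cong_mult cong_refl c)
  ultimately have "[a - b * int n = 0] (mod int p ^ m)"
    by (metis cong_trans diff_self mult.left_commute mult.right_neutral)
  then have d: "int p ^ m dvd a - b * int n" by (simp add: cong_0_iff)
  have eq: "r - of_nat n = of_int (a - b * int n) / of_int b"
    using b by (simp add: field_simps)
  show ?thesis
  proof (intro exI[of _ n], cases "a - b * int n = 0")
    case False
    have "m \<le> multiplicity (int p) (a - b * int n)"
      using d False p by (intro multiplicity_geI) auto
    moreover have "multiplicity (int p) b = 0"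
      using \<open>\<not> int p dvd b\<close> by (rule not_dvd_imp_multiplicity_0)
    ultimately show "ereal (real m) \<le> rat_val p (r - of_nat n)"
      unfolding eq using False b(1) by (simp add: rat_val_frac[OF p] del: of_int_diff of_int_mult)
  qed (simp add: eq)
qed

text \<open>Some far term of a representing sequence is within \<open>p ^ -m\<close> of all later
  terms, so a natural number close to that one rational is close to the limit.\<close>

lemma padic_near_nat:
  assumes p: "prime p" and x: "x \<in> carrier (Zp p)"
  shows "\<exists>n::nat. ereal (real m) \<le> padic_val p (x \<ominus>\<^bsub>Qp p\<^esub> padic_class p (\<lambda>_. of_nat n))"
proof -
  interpret cring "Qp p" by (rule cring_Qp[OF p])
  have x': "x \<in> carrier (Qp p)" "0 \<le> padic_val p x" using x by (auto simp: Zp_carrier_iff)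
  obtain s where s: "s \<in> carrier (cauchy_ring p)" "x = padic_class p s" using x'(1) by (rule Qp_carrierE)
  have "(\<lambda>n. rat_val p (s n)) \<longlonglongrightarrow> padic_val p x" using padic_val_tendsto[OF p s(1)] s(2) by simp
  \<comment> \<open>A strict bound passes from the limit to the terms; their valuations being
    integers or infinite, exceeding -1 means being nonnegative.\<close>
  moreover have "ereal (- 1) < padic_val p x" using x'(2) by (rule less_le_trans[rotated]) simp
  ultimately have "eventually (\<lambda>n. ereal (- 1) < rat_val p (s n)) sequentially"
    by (rule order_tendstoD)
  then obtain N where N: "\<And>n. n \<ge> N \<Longrightarrow> ereal (- 1) < rat_val p (s n)"
    unfolding eventually_sequentially by blast
  obtain M where M: "\<forall>i\<ge>M. \<forall>j\<ge>M. ereal (real m) \<le> rat_val p (s i - s j)"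
    using s(1) cauchy_ring_iff by metis
  define i where "i = max M N"
  have "0 \<le> rat_val p (s i)"
    using N[of i] rat_val_int[of p "s i"] by (auto simp: i_def)
  then obtain n :: nat where n: "ereal (real m) \<le> rat_val p (s i - of_nat n)"
    using rat_near_nat[OF p] by blast
  have le: "ereal (real m) \<le> rat_val p (s j - of_nat n)" if "j \<ge> i" for j
    using order_trans[OF min.boundedI rat_val_add[OF p, of "s j - s i" "s i - of_nat n"]] M n that
    by (auto simp: i_def)
  define c where "c = (\<lambda>_::nat. of_nat n :: rat)"
  have c: "c \<in> carrier (cauchy_ring p)" unfolding c_def by (rule cauchy_const)
  have "padic_class p (\<lambda>j. - c j + c j) = \<zero>\<^bsub>Qp p\<^esub>" by (simp add: Qp_zero')
  then have "padic_class p (\<lambda>j. - c j) \<oplus>\<^bsub>Qp p\<^esub> padic_class p c = \<zero>\<^bsub>Qp p\<^esub>"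
    using padic_class_add[OF p cauchy_minus[OF c] c] by simp
  then have "padic_class p (\<lambda>j. - c j) = \<ominus>\<^bsub>Qp p\<^esub> padic_class p c"
    by (intro sum_zero_eq_neg padic_class_carrier c cauchy_minus)
  then have "x \<ominus>\<^bsub>Qp p\<^esub> padic_class p c = padic_class p (\<lambda>j. s j + - c j)"
    unfolding a_minus_def s(2) using padic_class_add[OF p s(1) cauchy_minus[OF c]] by simp
  moreover have "ereal (real m) \<le> padic_val p (padic_class p (\<lambda>j. s j + - c j))"
    by (rule LIMSEQ_le_const[OF padic_val_tendsto[OF p cauchy_add[OF p s(1) cauchy_minus[OF c]]]])
       (use le in \<open>auto simp: c_def\<close>)
  ultimately show ?thesis unfolding c_def by (intro exI[of _ n]) simp
qed

section \<open>Valuations of finite adeles\<close>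

abbreviation adele_val :: "nat \<Rightarrow> adele \<Rightarrow> ereal" where
  "adele_val p x \<equiv> padic_val p (component p x)"

lemma component_eq_zero_iff:
  "prime p \<Longrightarrow> component p x = \<zero>\<^bsub>Qp p\<^esub> \<longleftrightarrow> adele_val p x = \<infinity>"
  using padic_val_cases[OF _ component_carrier, of p x] padic_val_zero[of p] by (metis PInfty_neq_ereal(1))

lemma component_eq_iff:
  assumes p: "prime p"
  shows "component p x = component p y \<longleftrightarrow> adele_val p (x - y) = \<infinity>"
proof -
  interpret cring "Qp p" by (rule cring_Qp[OF p])
  have "component p (x - y) = \<zero>\<^bsub>Qp p\<^esub> \<longleftrightarrow> component p x = component p y"
    using component_carrier[OF p, of x] component_carrier[OF p, of y]
    unfolding component_diff[OF p] by (metis a_minus_def minus_equality minus_minus r_neg a_inv_closed)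
  then show ?thesis by (simp only: component_eq_zero_iff[OF p])
qed

lemma adele_val_0 [simp]: "prime p \<Longrightarrow> adele_val p 0 = \<infinity>"
  and adele_val_1 [simp]: "prime p \<Longrightarrow> adele_val p 1 = 0"
  and adele_val_minus [simp]: "prime p \<Longrightarrow> adele_val p (- x) = adele_val p x"
  and adele_val_mult: "prime p \<Longrightarrow> adele_val p (x * y) = adele_val p x + adele_val p y"
  by (simp_all add: component_simps padic_val_zero padic_val_one padic_val_uminus padic_val_mult component_carrier)

lemma adele_val_commute: "prime p \<Longrightarrow> adele_val p (x - y) = adele_val p (y - x)"
  using adele_val_minus[of p "x - y"] by simp

lemma adele_val_add:
  assumes "prime p" "e \<le> adele_val p x" "e \<le> adele_val p y"
  shows "e \<le> adele_val p (x + y)"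
  using order_trans[OF min.boundedI padic_val_add] assms
  by (simp add: component_simps component_carrier)

lemma adele_val_diff:
  assumes "prime p" "e \<le> adele_val p x" "e \<le> adele_val p y"
  shows "e \<le> adele_val p (x - y)"
  using adele_val_add[of p e x "- y"] assms by simp

lemma adele_val_sum:
  assumes "prime p" "\<And>i. i \<in> A \<Longrightarrow> e \<le> adele_val p (f i)"
  shows "e \<le> adele_val p (sum f A)"
  using assms(2)
proof (induction A rule: infinite_finite_induct)
  case (insert x A)
  then show ?case using assms(1) by (simp add: adele_val_add)
qed (use assms(1) in simp_all)

lemma adele_val_prod:
  assumes "prime p"
  shows "adele_val p (prod f A) = (\<Sum>i\<in>A. adele_val p (f i))"
  by (induction A rule: infinite_finite_induct) (use assms in \<open>simp_all add: adele_val_mult\<close>)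

lemma adele_val_cases:
  assumes "prime p"
  obtains (inf) "adele_val p x = \<infinity>" | (int) k :: int where "adele_val p x = ereal (of_int k)"
  using padic_val_cases[OF assms component_carrier[OF assms], of x] padic_val_zero[OF assms] by metis

lemma adele_val_unit:
  assumes "prime p" "x * y = 1"
  shows "adele_val p y = - adele_val p x" "\<bar>adele_val p x\<bar> \<noteq> \<infinity>"
proof -
  have "adele_val p x + adele_val p y = 0" using adele_val_mult[OF assms(1), of x y] assms by simp
  then show "adele_val p y = - adele_val p x" "\<bar>adele_val p x\<bar> \<noteq> \<infinity>"
    by (cases "adele_val p x"; cases "adele_val p y"; simp)+
qed

section \<open>Profinite integers, gluing and units among the finite adeles\<close>

lemma component_Zp_iff: "prime p \<Longrightarrow> component p x \<in> carrier (Zp p) \<longleftrightarrow> 0 \<le> adele_val p x"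
  by (simp add: Zp_carrier_iff component_carrier)

lemma zhat_val_nonneg [simp]: "prime p \<Longrightarrow> 0 \<le> zhat_val p x"
  using of_zhat[of x] component_Zp_iff by auto

lemma range_of_zhat_iff: "x \<in> range of_zhat \<longleftrightarrow> (\<forall>p. prime p \<longrightarrow> 0 \<le> adele_val p x)"
proof
  assume "\<forall>p. prime p \<longrightarrow> 0 \<le> adele_val p x"
  then have "x = of_zhat (Abs_zhat x)" by (intro Abs_zhat_inverse[symmetric]) (simp add: component_Zp_iff)
  then show "x \<in> range of_zhat" by blast
qed auto

lemma adele_glue:
  assumes "\<And>p. prime p \<Longrightarrow> f p \<in> carrier (Qp p)" "finite {p. prime p \<and> f p \<notin> carrier (Zp p)}"
  shows "\<exists>x. \<forall>p. prime p \<longrightarrow> component p x = f p"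
proof -
  have "{p \<in> primes. (\<lambda>p\<in>primes. f p) p \<notin> carrier (Zp p)} = {p. prime p \<and> f p \<notin> carrier (Zp p)}"
    by auto
  then have "(\<lambda>p\<in>primes. f p) \<in> adele_set"
    using assms unfolding adele_set_def by auto
  from Abs_adele_inverse[OF this] show ?thesis
    by (intro exI[of _ "Abs_adele (\<lambda>p\<in>primes. f p)"]) (simp add: component.rep_eq)
qed

text \<open>Components are inverted one prime at a time; wherever the valuation is zero the inverse
  is integral, so the inverses obey the restricted product condition.\<close>

lemma adele_inverse:
  assumes "\<And>p. prime p \<Longrightarrow> adele_val p x \<noteq> \<infinity>" "finite {p. prime p \<and> adele_val p x \<noteq> 0}"
  shows "\<exists>y. x * y = 1"
proof -
  have "\<forall>p. \<exists>y. prime p \<longrightarrow> y \<in> carrier (Qp p) \<and> component p x \<otimes>\<^bsub>Qp p\<^esub> y = \<one>\<^bsub>Qp p\<^esub>"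
    using padic_inverse[OF _ component_carrier] assms(1) component_eq_zero_iff by metis
  then obtain f where f: "\<And>p. prime p \<Longrightarrow> f p \<in> carrier (Qp p)"
    "\<And>p. prime p \<Longrightarrow> component p x \<otimes>\<^bsub>Qp p\<^esub> f p = \<one>\<^bsub>Qp p\<^esub>" by metis
  have "f p \<in> carrier (Zp p)" if p: "prime p" "adele_val p x = 0" for p
    using padic_val_mult[OF p(1) component_carrier[OF p(1)] f(1)[OF p(1)], of x] f[OF p(1)] p padic_val_one[OF p(1)]
    by (simp add: Zp_carrier_iff)
  then have "finite {p. prime p \<and> f p \<notin> carrier (Zp p)}"
    by (intro finite_subset[OF _ assms(2)]) auto
  then obtain y where y: "\<forall>p. prime p \<longrightarrow> component p y = f p" using adele_glue[of f] f(1) by blast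
  have "x * y = 1" by (rule adele_eqI) (simp add: component_simps y f)
  then show ?thesis by blast
qed

lemma adele_inv_right:
  assumes "x * y = 1" shows "x * adele_inv x = 1"
proof -
  have "adele_inv x = y"
    unfolding adele_inv_def using assms by (intro the_equality) (auto, metis mult.left_commute mult.right_neutral)
  then show ?thesis using assms by simp
qed

section \<open>Natural numbers as finite adeles\<close>

lemma component_of_nat: "prime p \<Longrightarrow> component p (of_nat n) = padic_class p (\<lambda>_. of_nat n)"
proof (induction n)
  case (Suc n)
  then show ?case
    using padic_class_add[OF Suc(2) cauchy_const cauchy_const, of 1 "of_nat n"]
    by (simp add: component_simps Qp_one)
qed (simp add: component_simps Qp_zero')

lemma adele_val_of_nat: "prime p \<Longrightarrow> adele_val p (of_nat n) = rat_val p (of_nat n)"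
  using padic_val_tendsto[of p "\<lambda>_. of_nat n"] cauchy_const[of "of_nat n" p]
  by (simp add: component_of_nat LIMSEQ_const_iff)

lemma adele_val_of_nat_pos:
  assumes "prime p" "n > 0"
  shows "adele_val p (of_nat n) = ereal (real (multiplicity (int p) (int n)))"
  using rat_val_frac[OF assms(1), of "int n" 1] assms(2) adele_val_of_nat[OF assms(1), of n]
  by simp

lemma adele_val_of_nat_ge_iff:
  assumes "prime p"
  shows "ereal (real m) \<le> adele_val p (of_nat n) \<longleftrightarrow> p ^ m dvd n"
proof (cases "n = 0")
  case False
  then show ?thesis
    using assms power_dvd_iff_le_multiplicity[of "int n" "int p" m] int_dvd_int_iff[of "p ^ m" n] prime_gt_1_nat[OF assms]
    by (auto simp: adele_val_of_nat_pos)
qed (use assms in simp)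

text \<open>Only the finitely many prime divisors of \<open>n\<close> give it nonzero valuation.
  This provides the denominators \<open>j\<close> of the indicator polynomials.\<close>

lemma of_nat_adele_inverse:
  assumes "n > 0" shows "\<exists>y. of_nat n * y = (1 :: adele)"
proof (rule adele_inverse)
  have "{p. prime p \<and> adele_val p (of_nat n) \<noteq> 0} \<subseteq> {p. p dvd n}"
  proof
    fix p assume "p \<in> {p. prime p \<and> adele_val p (of_nat n) \<noteq> 0}"
    then have "multiplicity (int p) (int n) \<noteq> 0"
      using assms by (auto simp: adele_val_of_nat_pos zero_ereal_def)
    then show "p \<in> {p. p dvd n}"
      using not_dvd_imp_multiplicity_0[of "int p" "int n"] by auto
  qed
  then show "finite {p. prime p \<and> adele_val p (of_nat n) \<noteq> 0}"
    using assms finite_divisors_nat[of n] finite_subset by blast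
qed (use assms in \<open>simp add: adele_val_of_nat_pos\<close>)

text \<open>Reduction modulo \<open>p ^ m\<close> costs no precision, and the bound leaves finitely
  many representatives of the residue classes.\<close>

lemma adele_near_nat:
  assumes p: "prime p" and "0 \<le> adele_val p x"
  shows "\<exists>n<p ^ m. ereal (real m) \<le> adele_val p (x - of_nat n)"
proof -
  obtain n :: nat where n: "ereal (real m) \<le> adele_val p (x - of_nat n)"
    using padic_near_nat[OF p, of "component p x" m] assms
    by (auto simp: component_Zp_iff component_diff component_of_nat)
  have eq: "x - of_nat (n mod p ^ m) = (x - of_nat n) + of_nat (p ^ m) * of_nat (n div p ^ m)"
  proof -
    have "of_nat n = (of_nat (p ^ m * (n div p ^ m) + n mod p ^ m) :: adele)" by simp
    then show ?thesis by (simp only: of_nat_add of_nat_mult algebra_simps)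
  qed
  have "ereal (real m) \<le> adele_val p (of_nat (p ^ m * (n div p ^ m)))"
    using p by (simp add: adele_val_of_nat_ge_iff del: of_nat_mult of_nat_power)
  then have "ereal (real m) \<le> adele_val p (x - of_nat (n mod p ^ m))"
    unfolding eq using n p by (intro adele_val_add) (simp_all del: of_nat_power)
  then show ?thesis using prime_gt_0_nat[OF p] by (intro exI[of _ "n mod p ^ m"]) simp
qed

section \<open>Topology\<close>

lemma padic_val_diff_trans:
  assumes p: "prime p" and "x \<in> carrier (Qp p)" "y \<in> carrier (Qp p)" "z \<in> carrier (Qp p)"
    and "e \<le> padic_val p (x \<ominus>\<^bsub>Qp p\<^esub> y)" "e \<le> padic_val p (y \<ominus>\<^bsub>Qp p\<^esub> z)"
  shows "e \<le> padic_val p (x \<ominus>\<^bsub>Qp p\<^esub> z)"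
proof -
  interpret cring "Qp p" by (rule cring_Qp[OF p])
  have "x \<ominus>\<^bsub>Qp p\<^esub> z = (x \<ominus>\<^bsub>Qp p\<^esub> y) \<oplus>\<^bsub>Qp p\<^esub> (y \<ominus>\<^bsub>Qp p\<^esub> z)"
    using assms by (simp add: a_minus_def a_assoc r_neg1)
  then show ?thesis
    using order_trans[OF min.boundedI padic_val_add[OF p, of "x \<ominus>\<^bsub>Qp p\<^esub> y" "y \<ominus>\<^bsub>Qp p\<^esub> z"]] assms by simp
qed

text \<open>The distance is a decreasing function of the valuation and the radii
  \<open>p ^ -m\<close> shrink to zero, so congruences replace metric balls.\<close>

lemma openin_Zp_iff:
  assumes p: "prime p"
  shows "openin (Zp_topology p) U \<longleftrightarrow> U \<subseteq> carrier (Zp p) \<and>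
    (\<forall>x\<in>U. \<exists>m::nat. \<forall>y\<in>carrier (Zp p). ereal (real m) \<le> padic_val p (x \<ominus>\<^bsub>Qp p\<^esub> y) \<longrightarrow> y \<in> U)"
    (is "?L \<longleftrightarrow> ?R")
proof -
  interpret M: Metric_space "carrier (Qp p)" "padic_dist p" by (rule Metric_space_padic[OF p])
  interpret cring "Qp p" by (rule cring_Qp[OF p])
  have p1: "real p > 1" using prime_gt_1_nat[OF p] by simp
  show ?thesis
  proof
    assume ?L
    then obtain T where T: "openin M.mtopology T" "U = T \<inter> carrier (Zp p)"
      unfolding Zp_topology_def Qp_topology_def openin_subtopology by blast
    have "\<exists>m::nat. \<forall>y\<in>carrier (Zp p). ereal (real m) \<le> padic_val p (x \<ominus>\<^bsub>Qp p\<^esub> y) \<longrightarrow> y \<in> U" if x: "x \<in> U" for x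
    proof -
      have xq: "x \<in> carrier (Qp p)" using x T by (simp add: Zp_carrier_iff)
      obtain r where r: "r > 0" "M.mball x r \<subseteq> T"
        using T x unfolding M.openin_mtopology by auto
      obtain m where m: "(1 / real p) ^ m < r" using real_arch_pow_inv[OF r(1), of "1 / real p"] p1 by auto
      have pm: "(1 / real p) ^ m = real p powr (- real m)"
        using p1 by (simp add: powr_minus powr_realpow power_one_over divide_inverse power_inverse)
      have "y \<in> U" if y: "y \<in> carrier (Zp p)" "ereal (real m) \<le> padic_val p (x \<ominus>\<^bsub>Qp p\<^esub> y)" for y
      proof -
        have yq: "y \<in> carrier (Qp p)" using y by (simp add: Zp_carrier_iff)
        have "padic_dist p x y < r"
        proof (cases "x = y")
          case False
          have "x \<ominus>\<^bsub>Qp p\<^esub> y \<noteq> \<zero>\<^bsub>Qp p\<^esub>" using False xq yq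
            by (metis a_minus_def minus_equality minus_minus a_inv_closed)
          then obtain k :: int where k: "padic_val p (x \<ominus>\<^bsub>Qp p\<^esub> y) = ereal (of_int k)"
            using padic_val_cases[OF p, of "x \<ominus>\<^bsub>Qp p\<^esub> y"] xq yq by auto
          then have "real m \<le> of_int k" using y by simp
          then have "real p powr (- real_of_int k) \<le> real p powr (- real m)" using p1 by simp
          then show ?thesis using k m r(1) unfolding pm padic_dist_def by simp
        qed (use r M.mdist_zero[OF xq] in simp)
        then have "y \<in> M.mball x r" using xq yq by simp
        then show ?thesis using r T y by auto
      qed
      then show ?thesis by blast
    qed
    then show ?R using T by auto
  next
    assume R: ?R
    have "openin M.mtopology U"
      unfolding M.openin_mtopology
    proof (intro conjI allI impI)
      show "U \<subseteq> carrier (Qp p)" using R by (auto simp: Zp_carrier_iff)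
      fix x assume x: "x \<in> U"
      then have xz: "x \<in> carrier (Qp p)" "0 \<le> padic_val p x" using R by (auto simp: Zp_carrier_iff)
      obtain m :: nat where m: "\<And>y. y\<in>carrier (Zp p) \<Longrightarrow> ereal (real m) \<le> padic_val p (x \<ominus>\<^bsub>Qp p\<^esub> y) \<Longrightarrow> y \<in> U"
        using R x by blast
      have "y \<in> U" if y: "y \<in> M.mball x (real p powr (- real m))" for y
      proof (cases "x = y")
        case False
        have yq: "y \<in> carrier (Qp p)" using y by simp
        have "x \<ominus>\<^bsub>Qp p\<^esub> y \<noteq> \<zero>\<^bsub>Qp p\<^esub>" using False xz yq
          by (metis a_minus_def minus_equality minus_minus a_inv_closed)
        then obtain k :: int where k: "padic_val p (x \<ominus>\<^bsub>Qp p\<^esub> y) = ereal (of_int k)"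
          using padic_val_cases[OF p, of "x \<ominus>\<^bsub>Qp p\<^esub> y"] xz yq by auto
        have "real p powr (- real_of_int k) < real p powr (- real m)"
          using y k False xz(1) yq by (simp add: padic_dist_def)
        then have v: "ereal (real m) \<le> padic_val p (x \<ominus>\<^bsub>Qp p\<^esub> y)" using p1 k by simp
        \<comment> \<open>The ball is taken in the whole field; \<open>y\<close> is integral because
          it is an integral point minus an integral difference.\<close>
        have "y = x \<oplus>\<^bsub>Qp p\<^esub> \<ominus>\<^bsub>Qp p\<^esub> (x \<ominus>\<^bsub>Qp p\<^esub> y)"
          using xz yq by (simp add: a_minus_def minus_add a_assoc[symmetric] r_neg)
        moreover have "x \<ominus>\<^bsub>Qp p\<^esub> y \<in> carrier (Zp p)"
          using v xz yq by (auto simp: Zp_carrier_iff intro: order_trans[rotated])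
        moreover have "x \<in> carrier (Zp p)" using xz by (simp add: Zp_carrier_iff)
        ultimately have "y \<in> carrier (Zp p)" by (metis Zp_closed(3,5)[OF p])
        then show ?thesis using m v by blast
      qed (use x in simp)
      then show "\<exists>r>0. M.mball x r \<subseteq> U" using p1 by (intro exI[of _ "real p powr (- real m)"]) auto
    qed
    then show ?L
      unfolding Zp_topology_def Qp_topology_def openin_subtopology using R by blast
  qed
qed

lemma component_of_zhat_Zp: "prime p \<Longrightarrow> component p (of_zhat x) \<in> carrier (Zp p)"
  by (simp add: component_Zp_iff)

text \<open>Basic open sets of the product constrain finitely many coordinates, and finitely many
  radii can be replaced by the smallest one, hence a single exponent \<open>m\<close>.\<close>

lemma open_zhat_iff:
  "open (U :: zhat set) \<longleftrightarrow>
     (\<forall>x\<in>U. \<exists>F m. finite F \<and> F \<subseteq> primes \<and>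
        (\<forall>y. (\<forall>p\<in>F. ereal (real m) \<le> zhat_val p (x - y)) \<longrightarrow> y \<in> U))"
    (is "?L \<longleftrightarrow> ?R")
proof -
  let ?f = "\<lambda>x. \<lambda>p\<in>primes. component p (of_zhat x)"
  have f: "?f (zhat_of z) = z" "\<And>p. prime p \<Longrightarrow> component p (of_zhat (zhat_of z)) = z p"
    if z: "z \<in> (\<Pi>\<^sub>E p\<in>primes. carrier (Zp p))" for z
  proof -
    show *: "component p (of_zhat (zhat_of z)) = z p" if "prime p" for p
      by (rule component_zhat_of) (use z that in auto)
    show "?f (zhat_of z) = z" using z * by (auto simp: fun_eq_iff PiE_def extensional_def)
  qed
  show ?thesis
  proof
    assume ?L
    show ?R
    proof
      fix x assume "x \<in> U"
      then obtain V where V: "finite {p \<in> primes. V p \<noteq> topspace (Zp_topology p)}"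
          "\<And>p. prime p \<Longrightarrow> openin (Zp_topology p) (V p)" "?f x \<in> Pi\<^sub>E primes V" "Pi\<^sub>E primes V \<subseteq> ?f ` U"
        using \<open>?L\<close>[unfolded open_zhat_def openin_product_topology_alt, THEN bspec, OF imageI[of x U ?f]]
        by (elim meta_impE exE conjE) (assumption, blast)
      define F where "F = {p \<in> primes. V p \<noteq> topspace (Zp_topology p)}"
      have "\<exists>m::nat. \<forall>y\<in>carrier (Zp p). ereal (real m) \<le> padic_val p (component p (of_zhat x) \<ominus>\<^bsub>Qp p\<^esub> y) \<longrightarrow> y \<in> V p"
        if "p \<in> F" for p
      proof -
        have "prime p" using that by (simp add: F_def)
        then show ?thesis using V(2,3) openin_Zp_iff[of p "V p"] by (auto simp: PiE_iff)
      qed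
      then obtain m :: "nat \<Rightarrow> nat" where m: "\<And>p y. p \<in> F \<Longrightarrow> y\<in>carrier (Zp p) \<Longrightarrow>
          ereal (real (m p)) \<le> padic_val p (component p (of_zhat x) \<ominus>\<^bsub>Qp p\<^esub> y) \<Longrightarrow> y \<in> V p"
        by metis
      \<comment> \<open>Inserting 0 keeps \<open>Max\<close> meaningful when no coordinate is
        constrained.\<close>
      define K where "K = Max (insert 0 (m ` F))"
      have fin: "finite F" unfolding F_def by (rule V(1))
      have K: "m p \<le> K" if "p \<in> F" for p unfolding K_def using fin that by (intro Max_ge) auto
      have "y \<in> U" if y: "\<forall>p\<in>F. ereal (real K) \<le> zhat_val p (x - y)" for y
      proof -
        have "component p (of_zhat y) \<in> V p" if p: "prime p" for p
        proof (cases "p \<in> F")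
          case True
          have "ereal (real (m p)) \<le> zhat_val p (x - y)" using y True K[OF True] by (auto intro: order_trans[rotated])
          then show ?thesis using m[OF True component_of_zhat_Zp[OF p]] p by (simp add: component_diff)
        next
          case False
          then show ?thesis using p component_of_zhat_Zp[OF p] by (simp add: F_def topspace_Zp)
        qed
        then have "?f y \<in> ?f ` U" using V(4) by auto
        then obtain w where w: "w \<in> U" "?f y = ?f w" by auto
        have "of_zhat y = of_zhat w"
        proof (rule adele_eqI)
          show "component p (of_zhat y) = component p (of_zhat w)" if "prime p" for p
            using fun_cong[OF w(2), of p] that by simp
        qed
        then show ?thesis using w by (simp add: of_zhat_inject)
      qed
      then show "\<exists>F m. finite F \<and> F \<subseteq> primes \<and> (\<forall>y. (\<forall>p\<in>F. ereal (real m) \<le> zhat_val p (x - y)) \<longrightarrow> y \<in> U)"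
        using fin by (intro exI[of _ F] exI[of _ K]) (auto simp: F_def)
    qed
  next
    assume R: ?R
    show ?L
      unfolding open_zhat_def openin_product_topology_alt
    proof
      fix z assume "z \<in> ?f ` U"
      then obtain x where x: "x \<in> U" "z = ?f x" by blast
      obtain F m where F: "finite F" "F \<subseteq> primes"
          "\<And>y. (\<forall>p\<in>F. ereal (real m) \<le> zhat_val p (x - y)) \<Longrightarrow> y \<in> U"
        using R x by metis
      \<comment> \<open>A box: balls around \<open>x\<close> at the primes of \<open>F\<close>, all
        of the integers elsewhere.\<close>
      define V where "V = (\<lambda>p. if p \<in> F
        then {y \<in> carrier (Zp p). ereal (real m) \<le> padic_val p (component p (of_zhat x) \<ominus>\<^bsub>Qp p\<^esub> y)}
        else carrier (Zp p))"
      have sub: "V p \<subseteq> carrier (Zp p)" for p by (auto simp: V_def)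
      have "finite {p \<in> primes. V p \<noteq> topspace (Zp_topology p)}"
        by (rule finite_subset[OF _ F(1)]) (auto simp: V_def topspace_Zp)
      moreover have "openin (Zp_topology p) (V p)" if p: "prime p" for p
      proof (cases "p \<in> F")
        case True
        show ?thesis
          unfolding openin_Zp_iff[OF p] using True
          by (auto simp: V_def Zp_carrier_iff component_carrier[OF p]
              intro!: exI[of _ m] intro: padic_val_diff_trans[OF p])
      next
        case False
        then show ?thesis using openin_topspace[of "Zp_topology p"] p by (simp add: V_def topspace_Zp)
      qed
      moreover have "padic_val p (component p (of_zhat x) \<ominus>\<^bsub>Qp p\<^esub> component p (of_zhat x)) = \<infinity>" if p: "prime p" for p
        using adele_val_0[OF p] component_diff[OF p, of "of_zhat x" "of_zhat x"] by simp
      then have "z \<in> Pi\<^sub>E primes V"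
        using component_of_zhat_Zp[of _ x] by (auto simp: x(2) V_def)
      moreover have "Pi\<^sub>E primes V \<subseteq> ?f ` U"
      proof
        fix w assume w: "w \<in> Pi\<^sub>E primes V"
        then have wz: "w \<in> (\<Pi>\<^sub>E p\<in>primes. carrier (Zp p))" using sub by (auto simp: PiE_iff)
        have "zhat_of w \<in> U"
        proof (rule F(3), rule ballI)
          fix p assume p: "p \<in> F"
          then have "prime p" "w p \<in> V p" using F(2) w by auto
          then show "ereal (real m) \<le> zhat_val p (x - zhat_of w)"
            using p by (simp add: component_diff f(2)[OF wz] V_def)
        qed
        then show "w \<in> ?f ` U" using f(1)[OF wz] by (metis image_eqI)
      qed
      ultimately show "\<exists>V. finite {p \<in> primes. V p \<noteq> topspace (Zp_topology p)} \<and>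
          (\<forall>p\<in>primes. openin (Zp_topology p) (V p)) \<and> z \<in> Pi\<^sub>E primes V \<and> Pi\<^sub>E primes V \<subseteq> ?f ` U"
        by (intro exI[of _ V]) auto
    qed
  qed
qed

lemma open_zhat_val_ge:
  assumes p: "prime p"
  shows "open {y. ereal (real m) \<le> zhat_val p (x - y)}"
  unfolding open_zhat_iff
proof
  fix z assume z: "z \<in> {y. ereal (real m) \<le> zhat_val p (x - y)}"
  have "ereal (real m) \<le> zhat_val p (x - y)" if "ereal (real m) \<le> zhat_val p (z - y)" for y
    using z adele_val_add[OF p _ that, of "of_zhat (x - z)"] by (simp del: of_zhat_simps flip: of_zhat_simps(3))
  then show "\<exists>F n. finite F \<and> F \<subseteq> primes \<and>
      (\<forall>y. (\<forall>p\<in>F. ereal (real n) \<le> zhat_val p (z - y)) \<longrightarrow> y \<in> {y. ereal (real m) \<le> zhat_val p (x - y)})"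
    using p by (intro exI[of _ "{p}"] exI[of _ m]) auto
qed

text \<open>The preimage of the ball of radius \<open>p ^ -k\<close> about \<open>\<phi> p x\<close>
  is relatively open, hence contains a ball about \<open>x\<close> within
  \<open>E p\<close>.\<close>

lemma continuous_family_cont:
  assumes "continuous_family E \<phi>" and p: "prime p" and E: "E p \<subseteq> carrier (Zp p)" and x: "x \<in> E p"
  shows "\<phi> p x \<in> carrier (Zp p)"
    and "\<exists>m::nat. \<forall>y\<in>E p. ereal (real m) \<le> padic_val p (x \<ominus>\<^bsub>Qp p\<^esub> y) \<longrightarrow>
           ereal (real k) \<le> padic_val p (\<phi> p x \<ominus>\<^bsub>Qp p\<^esub> \<phi> p y)"
proof -
  have c: "continuous_map (subtopology (Zp_topology p) (E p)) (Zp_topology p) (\<phi> p)"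
    using assms(1) p by (simp add: continuous_family_def)
  have top: "topspace (subtopology (Zp_topology p) (E p)) = E p" using E p by (auto simp: topspace_Zp)
  show mem: "\<phi> p x \<in> carrier (Zp p)"
    using continuous_map_image_subset_topspace[OF c] x unfolding top by (auto simp: topspace_Zp[OF p])
  define U where "U = {z \<in> carrier (Zp p). ereal (real k) \<le> padic_val p (\<phi> p x \<ominus>\<^bsub>Qp p\<^esub> z)}"
  have "openin (Zp_topology p) U"
    unfolding openin_Zp_iff[OF p] using mem
    by (auto simp: U_def Zp_carrier_iff intro!: exI[of _ k] intro: padic_val_diff_trans[OF p])
  then have "openin (subtopology (Zp_topology p) (E p)) {y \<in> E p. \<phi> p y \<in> U}"
    using openin_continuous_map_preimage[OF c] unfolding top by blast
  then obtain T where T: "openin (Zp_topology p) T" "{y \<in> E p. \<phi> p y \<in> U} = T \<inter> E p"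
    by (auto simp: openin_subtopology)
  interpret cring "Qp p" by (rule cring_Qp[OF p])
  have "\<phi> p x \<ominus>\<^bsub>Qp p\<^esub> \<phi> p x = \<zero>\<^bsub>Qp p\<^esub>" using mem by (simp add: a_minus_def r_neg Zp_carrier_iff)
  then have "\<phi> p x \<in> U" using mem padic_val_zero[OF p] by (simp add: U_def)
  then have "x \<in> T" using T x by blast
  then obtain m :: nat where m: "\<forall>y\<in>carrier (Zp p). ereal (real m) \<le> padic_val p (x \<ominus>\<^bsub>Qp p\<^esub> y) \<longrightarrow> y \<in> T"
    using T(1) unfolding openin_Zp_iff[OF p] by blast
  show "\<exists>m::nat. \<forall>y\<in>E p. ereal (real m) \<le> padic_val p (x \<ominus>\<^bsub>Qp p\<^esub> y) \<longrightarrow>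
           ereal (real k) \<le> padic_val p (\<phi> p x \<ominus>\<^bsub>Qp p\<^esub> \<phi> p y)"
    using m T(2) E by (intro exI[of _ m]) (auto simp: U_def)
qed

section \<open>Adelic orderings\<close>

lemma of_zhat_prod [simp]: "of_zhat (prod f A) = (\<Prod>i\<in>A. of_zhat (f i))"
  by (induction A rule: infinite_finite_induct) simp_all

lemma adele_val_component_cong:
  "prime p \<Longrightarrow> component p x = component p y \<Longrightarrow> adele_val p (x - z) = adele_val p (y - z)"
  by (simp add: component_diff)

text \<open>If every value is infinite any point serves; otherwise the finite values are natural
  numbers and have a least one.\<close>

lemma zhat_val_least:
  assumes p: "prime p" and "S \<noteq> {}"
  shows "\<exists>y\<in>S. \<forall>z\<in>S. zhat_val p (f y) \<le> zhat_val p (f z)"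
proof (cases "\<exists>y\<in>S. zhat_val p (f y) \<noteq> \<infinity>")
  case True
  define m where "m = (\<lambda>y. nat \<lfloor>real_of_ereal (zhat_val p (f y))\<rfloor>)"
  have m: "zhat_val p (f y) = ereal (real (m y))" if fin: "zhat_val p (f y) \<noteq> \<infinity>" for y
  proof -
    obtain k :: int where k: "zhat_val p (f y) = ereal (of_int k)"
      using adele_val_cases[OF p, of "of_zhat (f y)"] fin by metis
    then have "k \<ge> 0" using zhat_val_nonneg[OF p, of "f y"] by simp
    then show ?thesis using k by (simp add: m_def)
  qed
  obtain y where y: "y \<in> S" "zhat_val p (f y) \<noteq> \<infinity>"
      "\<And>z. z \<in> S \<Longrightarrow> zhat_val p (f z) \<noteq> \<infinity> \<Longrightarrow> m y \<le> m z"
    using True ex_has_least_nat[of "\<lambda>y. y \<in> S \<and> zhat_val p (f y) \<noteq> \<infinity>" _ m] by blast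
  have "zhat_val p (f y) \<le> zhat_val p (f z)" if z: "z \<in> S" for z
  proof (cases "zhat_val p (f z) = \<infinity>")
    case False
    then show ?thesis using y(3)[OF z False] m[OF False] m[OF y(2)] by simp
  qed simp
  then show ?thesis using y(1) by blast
qed (use assms(2) in auto)

lemma add_pow_Zp:
  fixes n :: nat
  assumes "prime p"
  shows "[n] \<cdot>\<^bsub>Zp p\<^esub> component p x = component p (of_nat n * x)"
proof (induction n)
  case 0
  then show ?case using assms by (simp add: add_pow_def nat_pow_def Zp_def component_simps)
next
  case (Suc n)
  have "[Suc n] \<cdot>\<^bsub>Zp p\<^esub> component p x = [n] \<cdot>\<^bsub>Zp p\<^esub> component p x \<oplus>\<^bsub>Qp p\<^esub> component p x"
    by (simp add: add_pow_def nat_pow_def Zp_def)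
  also have "\<dots> = component p (of_nat n * x + x)" using Suc assms by (simp add: component_simps(3))
  finally show ?case by (simp add: algebra_simps)
qed

text \<open>A difference of positive valuation is \<open>p\<close> times an integral element. Read
  contrapositively, points in different residue classes differ by an element of valuation 0.\<close>

lemma p_ideal_coset_eq:
  assumes p: "prime p" and xy: "0 < zhat_val p (x - y)"
  shows "p_ideal p +>\<^bsub>Zp p\<^esub> component p (of_zhat x) = p_ideal p +>\<^bsub>Zp p\<^esub> component p (of_zhat y)"
proof -
  have sub: "p_ideal p +>\<^bsub>Zp p\<^esub> component p (of_zhat x) \<subseteq> p_ideal p +>\<^bsub>Zp p\<^esub> component p (of_zhat y)"
    if xy: "0 < zhat_val p (x - y)" for x y
  proof
    fix t assume "t \<in> p_ideal p +>\<^bsub>Zp p\<^esub> component p (of_zhat x)"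
    then obtain w where w: "w \<in> carrier (Zp p)" "t = [p] \<cdot>\<^bsub>Zp p\<^esub> w \<oplus>\<^bsub>Zp p\<^esub> component p (of_zhat x)"
      by (auto simp: a_r_coset_def' p_ideal_def)
    \<comment> \<open>\<open>w\<close> is extended by zero at the other primes, so the computation
      can take place in the ring of adeles.\<close>
    obtain W where W: "component p (of_zhat W) = w"
      using component_zhat_of[of "\<lambda>q. if q = p then w else \<zero>\<^bsub>Qp q\<^esub>", OF _ p] w(1) Zp_closed(1) by fastforce
    obtain u where u: "of_nat p * u = (1 :: adele)" using of_nat_adele_inverse prime_gt_0_nat[OF p] by blast
    \<comment> \<open>Divisibility by \<open>p\<close> but not by its square pins the valuation of
      \<open>p\<close> to 1.\<close>
    have "ereal (real 1) \<le> adele_val p (of_nat p)" using adele_val_of_nat_ge_iff[OF p, of 1 p] by simp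
    moreover have "\<not> ereal (real 2) \<le> adele_val p (of_nat p)"
      using adele_val_of_nat_ge_iff[OF p, of 2 p] prime_gt_1_nat[OF p]
      by (auto simp: power2_eq_square dest: dvd_imp_le)
    moreover obtain k :: int where k: "adele_val p (of_nat p) = ereal (of_int k)"
      using adele_val_cases[OF p, of "of_nat p"] adele_val_unit(2)[OF p u] by (metis abs_ereal.simps(3))
    ultimately have "adele_val p (of_nat p) = 1" by (simp add: one_ereal_def)
    then have vu: "adele_val p u = - 1" using adele_val_unit(1)[OF p u] by simp
    \<comment> \<open>With \<open>u\<close> the inverse of \<open>p\<close>, this \<open>z\<close>
      absorbs the difference: \<open>p * z + y = p * W + x\<close>.\<close>
    define z where "z = of_zhat W + of_zhat (x - y) * u"
    have "0 \<le> adele_val p (of_zhat (x - y) * u)"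
      using adele_val_cases[OF p, of "of_zhat (x - y)"] xy
      by (cases; simp add: adele_val_mult[OF p] vu one_ereal_def del: of_zhat_simps)
    then have z: "component p z \<in> carrier (Zp p)"
      unfolding z_def component_Zp_iff[OF p] using p by (intro adele_val_add) simp_all
    have "of_nat p * of_zhat W + of_zhat x = of_nat p * z + of_zhat y"
      unfolding z_def distrib_left mult.left_commute[of _ "of_zhat (x - y)"] u by simp
    then have "t = [p] \<cdot>\<^bsub>Zp p\<^esub> component p z \<oplus>\<^bsub>Zp p\<^esub> component p (of_zhat y)"
      unfolding w(2) W[symmetric] add_pow_Zp[OF p]
      by (simp add: Zp_def component_simps(3)[OF p, symmetric])
    then show "t \<in> p_ideal p +>\<^bsub>Zp p\<^esub> component p (of_zhat y)"
      using z by (auto simp: a_r_coset_def' p_ideal_def)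
  qed
  moreover have "0 < zhat_val p (y - x)" using xy adele_val_commute[OF p, of "of_zhat x"] by simp
  ultimately show ?thesis using xy by blast
qed

section \<open>Points of the product set and existence of an ordering\<close>

locale padic_product =
  fixes E :: "nat \<Rightarrow> padic set"
  assumes E_sub: "\<And>p. prime p \<Longrightarrow> E p \<subseteq> carrier (Zp p)"
    and E_infinite: "\<And>p. prime p \<Longrightarrow> infinite (E p)"
    and E_residues: "\<And>n::nat. finite {p. prime p \<and> \<not> n < card (mod_p p (E p))}"
begin

lemma glue_points:
  assumes "\<And>p. prime p \<Longrightarrow> x p \<in> E p"
  shows "\<exists>z\<in>zhat_prod E. \<forall>p. prime p \<longrightarrow> component p (of_zhat z) = x p"
proof -
  have "component p (of_zhat (zhat_of x)) = x p" if "prime p" for p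
    by (rule component_zhat_of) (use that assms E_sub in auto)
  then show ?thesis by (intro bexI[of _ "zhat_of x"]) (auto simp: zhat_prod_def assms)
qed

lemma point_exists:
  assumes p: "prime p" and x: "x \<in> E p"
  shows "\<exists>z\<in>zhat_prod E. component p (of_zhat z) = x"
proof -
  define f where "f = (\<lambda>q. if q = p then x else SOME y. y \<in> E q)"
  have "f q \<in> E q" if "prime q" for q
    using infinite_imp_nonempty[OF E_infinite[OF that]] x by (auto simp: f_def some_in_eq)
  then obtain z where "z \<in> zhat_prod E" "component p (of_zhat z) = f p" using glue_points[of f] p by blast
  then show ?thesis by (auto simp: f_def)
qed

lemma zhat_prod_nonempty: "zhat_prod E \<noteq> {}"
  using point_exists[OF two_is_prime_nat] infinite_imp_nonempty[OF E_infinite[OF two_is_prime_nat]] by blast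

text \<open>Minimisers for different primes can be chosen independently because the set is a full
  product. The valuation at \<open>p\<close> sees only the component at \<open>p\<close>, so the
  glued point minimises at every prime at once.\<close>

lemma next_point_exists:
  "\<exists>z\<in>zhat_prod E. \<forall>p y. prime p \<longrightarrow> y \<in> zhat_prod E \<longrightarrow>
     zhat_val p (\<Prod>k<n. z - \<alpha> k) \<le> zhat_val p (\<Prod>k<(n::nat). y - \<alpha> k)"
proof -
  have "\<forall>p. \<exists>y. prime p \<longrightarrow> y \<in> zhat_prod E \<and>
      (\<forall>z\<in>zhat_prod E. zhat_val p (\<Prod>k<n. y - \<alpha> k) \<le> zhat_val p (\<Prod>k<n. z - \<alpha> k))"
    using zhat_val_least[OF _ zhat_prod_nonempty, where f = "\<lambda>y. \<Prod>k<n. y - \<alpha> k"] by blast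
  from choice[OF this] obtain y where y: "\<And>p. prime p \<Longrightarrow> y p \<in> zhat_prod E"
      "\<And>p z. prime p \<Longrightarrow> z \<in> zhat_prod E \<Longrightarrow> zhat_val p (\<Prod>k<n. y p - \<alpha> k) \<le> zhat_val p (\<Prod>k<n. z - \<alpha> k)"
    by blast
  obtain z where z: "z \<in> zhat_prod E" "\<forall>p. prime p \<longrightarrow> component p (of_zhat z) = component p (of_zhat (y p))"
    using glue_points[of "\<lambda>p. component p (of_zhat (y p))"] y(1) by (auto simp: zhat_prod_def)
  have "zhat_val p (\<Prod>k<n. z - \<alpha> k) = zhat_val p (\<Prod>k<n. y p - \<alpha> k)" if p: "prime p" for p
  proof -
    have "adele_val p (of_zhat z - of_zhat (\<alpha> k)) = adele_val p (of_zhat (y p) - of_zhat (\<alpha> k))" for k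
      by (rule adele_val_component_cong[OF p]) (use z(2) p in blast)
    then show ?thesis by (simp add: adele_val_prod[OF p])
  qed
  then show ?thesis using y(2) z(1) by (intro bexI[of _ z]) auto
qed

text \<open>Well-founded recursion: the condition on \<open>\<alpha> n\<close> involves only earlier
  points. For \<open>n = 0\<close> the product is empty and any point qualifies.\<close>

lemma ordering_exists:
  "\<exists>\<alpha> :: nat \<Rightarrow> zhat. \<forall>n. \<alpha> n \<in> zhat_prod E \<and> (\<forall>p y. prime p \<longrightarrow> y \<in> zhat_prod E \<longrightarrow>
     zhat_val p (\<Prod>k<n. \<alpha> n - \<alpha> k) \<le> zhat_val p (\<Prod>k<n. y - \<alpha> k))"
  (is "\<exists>\<alpha>. \<forall>n. ?P \<alpha> n (\<alpha> n)")
proof (rule dependent_wf_choice[OF wf_less, where P = ?P])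
  fix f g :: "nat \<Rightarrow> zhat" and n :: nat and r
  assume "\<And>z. (z, n) \<in> {(x, y). x < y} \<Longrightarrow> f z = g z"
  then have "(\<Prod>k<n. y - f k) = (\<Prod>k<n. y - g k)" for y by (intro prod.cong) auto
  then show "?P f n r = ?P g n r" by simp
qed (use next_point_exists in blast)

end

section \<open>Consequences of simultaneous minimality\<close>

locale adelic_sequence = padic_product +
  fixes \<alpha> :: "nat \<Rightarrow> zhat"
  assumes \<alpha>_mem: "\<And>n. \<alpha> n \<in> zhat_prod E"
    and \<alpha>_min: "\<And>n p y. prime p \<Longrightarrow> y \<in> zhat_prod E \<Longrightarrow>
       zhat_val p (\<Prod>k<n. \<alpha> n - \<alpha> k) \<le> zhat_val p (\<Prod>k<n. y - \<alpha> k)"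
begin

text \<open>Infinitude of \<open>E p\<close> leaves a point differing at \<open>p\<close> from the
  first \<open>n\<close> terms; its product has finite valuation, which bounds the minimum.\<close>

lemma \<alpha>_prod_finite:
  assumes p: "prime p" shows "zhat_val p (\<Prod>k<n. \<alpha> n - \<alpha> k) \<noteq> \<infinity>"
proof -
  have "infinite (E p - (\<lambda>k. component p (of_zhat (\<alpha> k))) ` {..<n})"
    using E_infinite[OF p] by simp
  then obtain x where x: "x \<in> E p" "\<And>k. k < n \<Longrightarrow> x \<noteq> component p (of_zhat (\<alpha> k))"
    using infinite_imp_nonempty by blast
  obtain y where y: "y \<in> zhat_prod E" "component p (of_zhat y) = x" using point_exists[OF p x(1)] by blast
  have "zhat_val p (y - \<alpha> k) \<noteq> \<infinity>" if "k < n" for k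
    using component_eq_iff[OF p, of "of_zhat y" "of_zhat (\<alpha> k)"] x(2)[OF that] y by simp
  then have "zhat_val p (\<Prod>k<n. y - \<alpha> k) \<noteq> \<infinity>"
    by (auto simp: adele_val_prod[OF p] sum_Pinfty)
  then show ?thesis using \<alpha>_min[OF p y(1), of n] by auto
qed

text \<open>Pigeonhole: the first \<open>n\<close> terms occupy at most \<open>n\<close> residue
  classes, so some point of \<open>E p\<close> lies in another class and makes every factor a unit
  at \<open>p\<close>.\<close>

lemma \<alpha>_prod_zero:
  assumes p: "prime p" and n: "n < card (mod_p p (E p))"
  shows "zhat_val p (\<Prod>k<n. \<alpha> n - \<alpha> k) = 0"
proof -
  let ?c = "\<lambda>x. p_ideal p +>\<^bsub>Zp p\<^esub> x"
  have "card ((\<lambda>k. ?c (component p (of_zhat (\<alpha> k)))) ` {..<n}) \<le> n"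
    using card_image_le[of "{..<n}"] by simp
  then have "\<not> mod_p p (E p) \<subseteq> (\<lambda>k. ?c (component p (of_zhat (\<alpha> k)))) ` {..<n}"
    using n card_mono[of "(\<lambda>k. ?c (component p (of_zhat (\<alpha> k)))) ` {..<n}" "mod_p p (E p)"] by auto
  then obtain x where x: "x \<in> E p" "\<And>k. k < n \<Longrightarrow> ?c x \<noteq> ?c (component p (of_zhat (\<alpha> k)))"
    unfolding mod_p_def by auto
  obtain y where y: "y \<in> zhat_prod E" "component p (of_zhat y) = x" using point_exists[OF p x(1)] by blast
  have "zhat_val p (y - \<alpha> k) = 0" if "k < n" for k
    using p_ideal_coset_eq[OF p, of y "\<alpha> k"] x(2)[OF that] y zhat_val_nonneg[OF p, of "y - \<alpha> k"]
    by (metis less_eq_ereal_def)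
  then have "zhat_val p (\<Prod>k<n. y - \<alpha> k) = 0"
    by (simp add: adele_val_prod[OF p])
  then show ?thesis using \<alpha>_min[OF p y(1), of n] zhat_val_nonneg[OF p] by (metis antisym)
qed

lemma \<alpha>_prod_zero_almost_all: "finite {p. prime p \<and> zhat_val p (\<Prod>k<n. \<alpha> n - \<alpha> k) \<noteq> 0}"
  by (rule finite_subset[OF _ E_residues[of n]]) (use \<alpha>_prod_zero in blast)

lemma adelic_ordering: "adelic_ordering (zhat_prod E) \<alpha>"
  unfolding adelic_ordering_def
proof (intro conjI allI impI)
  show "zhat_val p (\<Prod>k<n. \<alpha> n - \<alpha> k) = (INF y\<in>zhat_prod E. zhat_val p (\<Prod>k<n. y - \<alpha> k))"
    if "prime p \<and> n \<ge> 1" for p n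
    by (rule antisym) (use that \<alpha>_min \<alpha>_mem in \<open>blast intro: INF_greatest INF_lower\<close>)+
qed (use \<alpha>_mem \<alpha>_prod_zero_almost_all in auto)

abbreviation D :: "nat \<Rightarrow> adele" where
  "D n \<equiv> \<Prod>k<n. of_zhat (\<alpha> n) - of_zhat (\<alpha> k)"

abbreviation g :: "nat \<Rightarrow> adele poly" where
  "g \<equiv> ordering_poly \<alpha>"

text \<open>A factor of a unit is a unit, so each single difference is invertible and
  \<open>adele_inv\<close> returns true inverses rather than unspecified values.\<close>

lemma D_inverse: "D n * (\<Prod>k<n. adele_inv (of_zhat (\<alpha> n) - of_zhat (\<alpha> k))) = 1"
proof -
  obtain u where u: "D n * u = 1"
    using adele_inverse[of "D n"] \<alpha>_prod_finite[of _ n] \<alpha>_prod_zero_almost_all[of n] by auto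
  have "(of_zhat (\<alpha> n) - of_zhat (\<alpha> k)) * adele_inv (of_zhat (\<alpha> n) - of_zhat (\<alpha> k)) = 1" if "k < n" for k
  proof -
    have "D n = (of_zhat (\<alpha> n) - of_zhat (\<alpha> k)) * (\<Prod>k\<in>{..<n} - {k}. of_zhat (\<alpha> n) - of_zhat (\<alpha> k))"
      using that by (intro prod.remove) auto
    then show ?thesis using u by (intro adele_inv_right) (simp add: mult.assoc)
  qed
  then show ?thesis by (simp flip: prod.distrib)
qed

lemma poly_g:
  "poly (g n) x = (\<Prod>k<n. adele_inv (of_zhat (\<alpha> n) - of_zhat (\<alpha> k))) * (\<Prod>k<n. x - of_zhat (\<alpha> k))"
  by (simp add: ordering_poly_def poly_prod prod.distrib[symmetric] algebra_simps)

lemma smult_D_g: "smult (D n) (g n) = (\<Prod>k<n. [:- of_zhat (\<alpha> k), 1:])"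
  using D_inverse[of n] by (simp add: ordering_poly_def prod_smult del: smult_pCons)

lemma poly_g_diag [simp]: "poly (g n) (of_zhat (\<alpha> n)) = 1"
  using D_inverse[of n] by (simp add: poly_g mult.commute)

lemma poly_g_below: "m < n \<Longrightarrow> poly (g n) (of_zhat (\<alpha> m)) = 0"
  unfolding poly_g by (subst prod_zero[of "{..<n}" "\<lambda>k. of_zhat (\<alpha> m) - of_zhat (\<alpha> k)"]) auto

text \<open>By minimality the numerator at \<open>y\<close> has at least the valuation of the
  denominator \<open>D n\<close>.\<close>

lemma poly_g_val:
  assumes p: "prime p" and y: "y \<in> zhat_prod E"
  shows "0 \<le> adele_val p (poly (g n) (of_zhat y))"
proof -
  let ?u = "\<Prod>k<n. adele_inv (of_zhat (\<alpha> n) - of_zhat (\<alpha> k))"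
  have "D n * ?u = 1" by (rule D_inverse)
  note u = adele_val_unit[OF p this]
  have "adele_val p (D n) \<le> adele_val p (\<Prod>k<n. of_zhat y - of_zhat (\<alpha> k))"
    using \<alpha>_min[OF p y, of n] by simp
  then show ?thesis
    unfolding poly_g adele_val_mult[OF p] u(1) using u(2)
    by (cases "adele_val p (D n)"; cases "adele_val p (\<Prod>k<n. of_zhat y - of_zhat (\<alpha> k))") auto
qed

lemma sum_g_\<alpha>:
  assumes "n < N"
  shows "(\<Sum>k<N. b k * poly (g k) (of_zhat (\<alpha> n))) = (\<Sum>k<n. b k * poly (g k) (of_zhat (\<alpha> n))) + b n"
proof -
  have "(\<Sum>k<N. b k * poly (g k) (of_zhat (\<alpha> n))) = (\<Sum>k<Suc n. b k * poly (g k) (of_zhat (\<alpha> n)))"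
    by (rule sum.mono_neutral_right) (use assms in \<open>auto simp: poly_g_below\<close>)
  then show ?thesis by simp
qed

text \<open>Integral values of the polynomials at the nodes let a lower bound on \<open>F\<close>
  pass through the recursion. It is used with \<open>e\<close> equal to 0, to a precision, and to an
  infimum.\<close>

lemma triangular_val:
  assumes p: "prime p"
    and d: "\<And>n. d n = F (\<alpha> n) - (\<Sum>k<n. d k * poly (g k) (of_zhat (\<alpha> n)))"
    and F: "\<And>x. x \<in> zhat_prod E \<Longrightarrow> e \<le> adele_val p (F x)"
  shows "e \<le> adele_val p (d n)"
proof (induction n rule: less_induct)
  case (less n)
  show ?case
    unfolding d[of n] using less poly_g_val[OF p \<alpha>_mem]
    by (intro adele_val_diff adele_val_sum F \<alpha>_mem p)
       (auto simp: adele_val_mult[OF p] intro: add_increasing2)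
qed

end

section \<open>Newton interpolation\<close>

text \<open>Nodes are split off one at a time: divide by the monic factor of the first node, then
  expand the quotient at the shifted nodes.\<close>

lemma newton_expansion:
  fixes f :: "'a :: comm_ring_1 poly"
  assumes "degree f < N"
  shows "\<exists>b. f = (\<Sum>n<N. smult (b n) (\<Prod>k<n. [:- \<beta> k, 1:]))"
  using assms
proof (induction N arbitrary: f \<beta>)
  case (Suc N)
  show ?case
  proof (cases "degree f = 0")
    case True
    then obtain c where "f = [:c:]" by (rule degree_eq_zeroE)
    then show ?thesis
      by (intro exI[of _ "\<lambda>n. if n = 0 then c else 0"]) (simp add: sum.lessThan_Suc_shift del: sum.lessThan_Suc)
  next
    case False
    have "degree (synthetic_div f (\<beta> 0)) < N" using Suc.prems False by (simp add: degree_synthetic_div)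
    then obtain b where b: "synthetic_div f (\<beta> 0) = (\<Sum>n<N. smult (b n) (\<Prod>k<n. [:- \<beta> (Suc k), 1:]))"
      using Suc.IH[of _ "\<lambda>k. \<beta> (Suc k)"] by blast
    have "f = [:- \<beta> 0, 1:] * synthetic_div f (\<beta> 0) + [:poly f (\<beta> 0):]"
      by (rule synthetic_div_correct'[symmetric])
    also have "\<dots> = (\<Sum>n<Suc N. smult (case n of 0 \<Rightarrow> poly f (\<beta> 0) | Suc n \<Rightarrow> b n) (\<Prod>k<n. [:- \<beta> k, 1:]))"
      unfolding b sum.lessThan_Suc_shift prod.lessThan_Suc_shift sum_distrib_left
      by (simp add: mult_smult_right del: mult_pCons_left)
    finally show ?thesis by blast
  qed
qed simp

section \<open>Expansion of polynomials and the basis property\<close>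

context adelic_sequence
begin

text \<open>Newton's products are the multiples of \<open>g n\<close> by the units
  \<open>D n\<close>. Extending \<open>b\<close> by zero makes the recursion hold at every index,
  ready for comparison with the coefficients of a function.\<close>

lemma g_expansion:
  obtains b where "f = (\<Sum>n<Suc (degree f). smult (b n) (g n))" "\<And>n. n > degree f \<Longrightarrow> b n = 0"
    "\<And>n. b n = poly f (of_zhat (\<alpha> n)) - (\<Sum>k<n. b k * poly (g k) (of_zhat (\<alpha> n)))"
proof -
  let ?N = "Suc (degree f)"
  obtain b0 where b0: "f = (\<Sum>n<?N. smult (b0 n) (\<Prod>k<n. [:- of_zhat (\<alpha> k), 1:]))"
    using newton_expansion[of f ?N "\<lambda>k. of_zhat (\<alpha> k)"] by auto
  define b where "b = (\<lambda>n. if n < ?N then b0 n * D n else 0)"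
  have f: "f = (\<Sum>n<?N. smult (b n) (g n))"
    by (subst b0, rule sum.cong) (simp_all add: b_def smult_D_g flip: smult_smult)
  have "b n = poly f (of_zhat (\<alpha> n)) - (\<Sum>k<n. b k * poly (g k) (of_zhat (\<alpha> n)))" for n
  proof -
    have "poly f (of_zhat (\<alpha> n)) = (\<Sum>k<?N. b k * poly (g k) (of_zhat (\<alpha> n)))"
      by (subst f) (simp add: poly_sum del: sum.lessThan_Suc)
    \<comment> \<open>Padding with zero coefficients brings the index \<open>n\<close> into range,
      as \<open>sum_g_\<alpha>\<close> requires.\<close>
    also have "\<dots> = (\<Sum>k<max ?N (Suc n). b k * poly (g k) (of_zhat (\<alpha> n)))"
      by (rule sum.mono_neutral_left) (auto simp: b_def)
    finally show ?thesis using sum_g_\<alpha>[of n "max ?N (Suc n)" b] by (simp del: sum.lessThan_Suc)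
  qed
  moreover have "b n = 0" if "n > degree f" for n using that by (simp add: b_def)
  ultimately show ?thesis by (intro that[OF f])
qed

lemma basis: "zhat_basis (int_valued (zhat_prod E)) g"
  unfolding zhat_basis_def
proof (intro conjI)
  show inj: "inj g"
  proof (rule linorder_injI)
    fix m n :: nat assume "m < n"
    then show "g m \<noteq> g n" using poly_g_below[of m n] poly_g_diag[of m] by (metis zero_neq_one)
  qed
  show "zhat_module.independent (range g)"
    unfolding zhat_module.independent_explicit_module
  proof (intro allI impI)
    fix t u v
    assume t: "finite t" "t \<subseteq> range g" "(\<Sum>v\<in>t. zhat_scale (u v) v) = 0" and v: "v \<in> t"
    define T where "T = g -` t"
    have T: "t = g ` T" using t(2) by (auto simp: T_def)
    have finT: "finite T" unfolding T_def by (rule finite_vimageI[OF t(1) inj])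
    have sum0: "(\<Sum>n\<in>T. zhat_scale (u (g n)) (g n)) = 0"
      using t(3) unfolding T by (subst (asm) sum.reindex) (use inj in \<open>auto intro: inj_on_subset\<close>)
    \<comment> \<open>Evaluate the relation at \<open>\<alpha> n\<close>: smaller indices are gone
      by induction, larger ones vanish there, and what remains is the coefficient itself.\<close>
    have "u (g n) = 0" if "n \<in> T" for n
      using that
    proof (induction n rule: less_induct)
      case (less n)
      have "0 = poly (\<Sum>k\<in>T. zhat_scale (u (g k)) (g k)) (of_zhat (\<alpha> n))" by (simp add: sum0)
      also have "\<dots> = (\<Sum>k\<in>T. of_zhat (u (g k)) * poly (g k) (of_zhat (\<alpha> n)))"
        by (simp add: poly_sum zhat_scale_def)
      also have "\<dots> = (\<Sum>k\<in>{n}. of_zhat (u (g k)) * poly (g k) (of_zhat (\<alpha> n)))"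
      proof (rule sum.mono_neutral_right)
        show "\<forall>k\<in>T - {n}. of_zhat (u (g k)) * poly (g k) (of_zhat (\<alpha> n)) = 0"
        proof
          fix k assume k: "k \<in> T - {n}"
          then consider "k < n" | "n < k" by fastforce
          then show "of_zhat (u (g k)) * poly (g k) (of_zhat (\<alpha> n)) = 0"
            using less.IH k by cases (simp_all add: poly_g_below)
        qed
      qed (use finT less in auto)
      finally show ?case by (simp add: of_zhat_inject flip: of_zhat_simps(1))
    qed
    then show "u v = 0" using v T by blast
  qed
  show "zhat_module.span (range g) = int_valued (zhat_prod E)"
  proof
    have "zhat_module.subspace (int_valued (zhat_prod E))"
      unfolding zhat_module.subspace_def int_valued_def range_of_zhat_iff
      by (auto simp: zhat_scale_def adele_val_mult intro: adele_val_add)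
    moreover have "range g \<subseteq> int_valued (zhat_prod E)"
      by (auto simp: int_valued_def range_of_zhat_iff poly_g_val)
    ultimately show "zhat_module.span (range g) \<subseteq> int_valued (zhat_prod E)"
      by (intro zhat_module.span_minimal)
    show "int_valued (zhat_prod E) \<subseteq> zhat_module.span (range g)"
    proof
      fix f assume f: "f \<in> int_valued (zhat_prod E)"
      obtain b where b: "f = (\<Sum>n<Suc (degree f). smult (b n) (g n))"
          "\<And>n. b n = poly f (of_zhat (\<alpha> n)) - (\<Sum>k<n. b k * poly (g k) (of_zhat (\<alpha> n)))"
        using g_expansion by metis
      \<comment> \<open>The bound 0 in \<open>triangular_val\<close> turns integrality of the values
        into integrality of the coefficients.\<close>
      have "0 \<le> adele_val p (b n)" if p: "prime p" for n p
        by (rule triangular_val[OF p b(2)]) (use f p in \<open>auto simp: int_valued_def range_of_zhat_iff\<close>)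
      then have "b n \<in> range of_zhat" for n unfolding range_of_zhat_iff by blast
      then have "\<forall>n. \<exists>c. b n = of_zhat c" by blast
      from choice[OF this] obtain c where c: "\<And>n. b n = of_zhat (c n)" by blast
      have "(\<Sum>n<Suc (degree f). zhat_scale (c n) (g n)) \<in> zhat_module.span (range g)"
        by (intro zhat_module.span_sum zhat_module.span_scale zhat_module.span_base) auto
      then show "f \<in> zhat_module.span (range g)"
        by (subst b(1)) (simp only: c zhat_scale_def)
    qed
  qed
qed

end

section \<open>Polynomial approximation of continuous functions\<close>

text \<open>Congruences multiply among integral factors; one factor is exchanged at a time.\<close>

lemma adele_val_prod_diff:
  assumes p: "prime p"
    and "\<And>i. i \<in> A \<Longrightarrow> e \<le> adele_val p (f i - h i)"
    and "\<And>i. i \<in> A \<Longrightarrow> 0 \<le> adele_val p (f i)" "\<And>i. i \<in> A \<Longrightarrow> 0 \<le> adele_val p (h i)"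
  shows "e \<le> adele_val p (prod f A - prod h A)"
  using assms(2-4)
proof (induction A rule: infinite_finite_induct)
  case (insert i A)
  have nonneg: "0 \<le> adele_val p (prod h A)"
    unfolding adele_val_prod[OF p] using insert by (intro sum_nonneg) auto
  have "f i * prod f A - h i * prod h A = f i * (prod f A - prod h A) + prod h A * (f i - h i)"
    by (simp add: algebra_simps)
  also have "e \<le> adele_val p \<dots>"
    using insert nonneg by (intro adele_val_add[OF p]) (auto simp: adele_val_mult[OF p] intro!: add_increasing)
  finally show ?case using insert by simp
qed (use p in simp_all)

text \<open>Truncated subtraction is harmless: for \<open>q > n\<close> a factor is 0, as is the
  binomial coefficient.\<close>

lemma prod_diff_eq_binomial:
  fixes n q :: nat
  shows "(\<Prod>j<q. n - j) = fact q * (n choose q)"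
proof (induction q)
  case (Suc q)
  have "Suc q * (n choose Suc q) = (n - q) * (n choose q)"
    by (metis binomial_absorption binomial_absorb_comp)
  then have "fact q * (n choose q) * (n - q) = fact q * (Suc q * (n choose Suc q))"
    by (simp only: ac_simps)
  then show ?case using Suc by (simp add: algebra_simps)
qed simp

text \<open>This is integrality of the binomial coefficient at a \<open>p\<close>-adic integer. It
  is transferred from natural numbers by replacing \<open>t\<close> by one congruent to it modulo
  \<open>p ^ M\<close>, where \<open>M\<close> is the valuation of \<open>fact q\<close>.\<close>

lemma adele_val_fact_le:
  assumes p: "prime p" and t: "0 \<le> adele_val p t"
  shows "adele_val p (of_nat (fact q)) \<le> adele_val p (\<Prod>j<q. t - of_nat j)"
proof -
  obtain M where M: "adele_val p (of_nat (fact q)) = ereal (real M)"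
    using adele_val_of_nat_pos[OF p, of "fact q"] by auto
  obtain n where n: "ereal (real M) \<le> adele_val p (t - of_nat n)"
    using adele_near_nat[OF p t] by blast
  have nat_nonneg: "0 \<le> adele_val p (of_nat i)" for i
    using adele_val_of_nat_ge_iff[OF p, of 0 i] by (simp add: zero_ereal_def)
  have "ereal (real M) \<le> adele_val p (\<Prod>j<q. of_nat n - of_nat j)"
  proof (cases "q \<le> n")
    case True
    have "(\<Prod>j<q. of_nat n - of_nat j :: adele) = of_nat (\<Prod>j<q. n - j)"
      unfolding of_nat_prod by (rule prod.cong) (use True in \<open>auto simp: of_nat_diff\<close>)
    then have "(\<Prod>j<q. of_nat n - of_nat j :: adele) = of_nat (fact q) * of_nat (n choose q)"
      unfolding prod_diff_eq_binomial of_nat_mult .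
    then show ?thesis
      by (simp only: adele_val_mult[OF p] M add_increasing2[OF nat_nonneg order_refl])
  next
    case False
    then have "(\<Prod>j<q. of_nat n - of_nat j :: adele) = 0" by (intro prod_zero) auto
    then show ?thesis using p by simp
  qed
  moreover have "ereal (real M) \<le> adele_val p ((\<Prod>j<q. t - of_nat j) - (\<Prod>j<q. of_nat n - of_nat j))"
    by (rule adele_val_prod_diff[OF p]) (use n t nat_nonneg in \<open>auto intro: adele_val_diff[OF p]\<close>)
  ultimately show ?thesis
    unfolding M using adele_val_add[OF p] by fastforce
qed

lemma ball_indicator_mod_p:
  assumes p: "prime p"
  shows "\<exists>h :: adele poly. \<forall>x. 0 \<le> adele_val p x \<longrightarrow>
    1 \<le> adele_val p (poly h x - (if ereal (real m) \<le> adele_val p (x - of_nat a) then 1 else 0))"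
proof -
  define q where "q = p ^ m"
  have q: "q > 0" using prime_gt_0_nat[OF p] by (simp add: q_def)
  obtain u where u: "\<And>j. j \<in> {1..<q} \<Longrightarrow> of_nat j * u j = (1 :: adele)"
    using of_nat_adele_inverse by (metis atLeastLessThan_iff less_eq_Suc_le One_nat_def)
  \<comment> \<open>With \<open>u j\<close> inverse to \<open>j\<close>, this is the product of the
    factors \<open>1 - (x - a) / j\<close>.\<close>
  define h where "h = (\<Prod>j\<in>{1..<q}. [:1 + of_nat a * u j, - u j:])"
  have h: "poly h x = (\<Prod>j\<in>{1..<q}. 1 - u j * (x - of_nat a))" for x
    unfolding h_def poly_prod by (rule prod.cong) (auto simp: algebra_simps)
  have "1 \<le> adele_val p (poly h x - (if ereal (real m) \<le> adele_val p (x - of_nat a) then 1 else 0))"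
    if x: "0 \<le> adele_val p x" for x
  proof -
    define t where "t = x - of_nat a"
    have t0: "0 \<le> adele_val p t"
      unfolding t_def using x adele_val_of_nat_ge_iff[OF p, of 0 a]
      by (intro adele_val_diff[OF p]) (simp_all add: zero_ereal_def)
    show ?thesis
    proof (cases "ereal (real m) \<le> adele_val p t")
      case True
      \<comment> \<open>Since \<open>0 < j < p ^ m\<close>, the valuation of \<open>j\<close> is
        below \<open>m\<close>, so \<open>t / j\<close> is divisible by \<open>p\<close> and every
        factor is congruent to 1.\<close>
      have ut: "1 \<le> adele_val p (u j * t)" if j: "j \<in> {1..<q}" for j
      proof -
        obtain k where k: "adele_val p (of_nat j) = ereal (real k)"
          using adele_val_of_nat_pos[OF p, of j] j by auto
        have "\<not> p ^ m dvd j" using j by (auto simp: q_def dest: dvd_imp_le)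
        then have "k < m" using adele_val_of_nat_ge_iff[OF p, of m j] k by simp
        then show ?thesis
          using True adele_val_unit(1)[OF p u[OF j]] k
          by (cases "adele_val p t") (auto simp: adele_val_mult[OF p] one_ereal_def)
      qed
      have "1 \<le> adele_val p ((\<Prod>j\<in>{1..<q}. 1 - u j * t) - (\<Prod>j\<in>{1..<q}. 1))"
      proof (rule adele_val_prod_diff[OF p])
        fix j assume j: "j \<in> {1..<q}"
        show "1 \<le> adele_val p (1 - u j * t - 1)" using ut[OF j] p by simp
        show "0 \<le> adele_val p (1 - u j * t)"
          using ut[OF j] p by (intro adele_val_diff[OF p]) (auto intro: order_trans[of _ 1])
      qed (use p in simp)
      then show ?thesis using True by (simp add: h t_def)
    next
      case False
      then obtain k :: int where k: "adele_val p t = ereal (of_int k)"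
        using adele_val_cases[OF p, of t] by (metis ereal_less_eq(1))
      have km: "k < int m" using False k by simp
      \<comment> \<open>Outside the ball the value is \<open>P / J\<close> up to sign. As
        \<open>t * P\<close> is the falling product and \<open>of_nat q * J\<close> the factorial,
        \<open>adele_val_fact_le\<close> gives valuation at least \<open>m - k\<close>, which is
        positive.\<close>
      define J where "J = (\<Prod>j\<in>{1..<q}. of_nat j :: adele)"
      define P where "P = (\<Prod>j\<in>{1..<q}. t - of_nat j)"
      have Ju: "J * (\<Prod>j\<in>{1..<q}. u j) = 1"
        unfolding J_def prod.distrib[symmetric] using u by simp
      note vJ = adele_val_unit[OF p Ju]
      have "adele_val p (1 - u j * t) = adele_val p (u j * (t - of_nat j))" if j: "j \<in> {1..<q}" for j
        using adele_val_commute[OF p, of 1 "u j * t"] u[OF j] by (simp add: algebra_simps)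
      then have "adele_val p (poly h x) = adele_val p (\<Prod>j\<in>{1..<q}. u j * (t - of_nat j))"
        unfolding h t_def[symmetric] adele_val_prod[OF p] by (intro sum.cong) auto
      then have v: "adele_val p (poly h x) = - adele_val p J + adele_val p P"
        unfolding prod.distrib adele_val_mult[OF p] vJ(1) P_def .
      have "{..<q} = insert 0 {1..<q}" using q by auto
      then have "(\<Prod>j<q. t - of_nat j) = t * P" by (simp add: P_def)
      moreover have "of_nat (fact q) = of_nat q * J"
      proof -
        have "fact q = q * fact (q - 1)" using q by (metis fact_reduce of_nat_id)
        moreover have "{1..<q} = {1..q - 1}" using q by auto
        ultimately show ?thesis by (simp add: J_def fact_prod of_nat_prod)
      qed
      ultimately have "adele_val p (of_nat q) + adele_val p J \<le> adele_val p t + adele_val p P"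
        using adele_val_fact_le[OF p t0, of q] by (simp add: adele_val_mult[OF p])
      moreover have "ereal (real m) \<le> adele_val p (of_nat q)"
        unfolding adele_val_of_nat_ge_iff[OF p] q_def by simp
      ultimately have "ereal (real m) + adele_val p J \<le> ereal (of_int k) + adele_val p P"
        unfolding k by (meson add_right_mono order_trans)
      then have "1 \<le> adele_val p (poly h x)"
        unfolding v using vJ(2) km by (cases "adele_val p J"; cases "adele_val p P") (auto simp: one_ereal_def)
      then show ?thesis using False by (simp add: t_def)
    qed
  qed
  then show ?thesis by blast
qed

lemma adele_val_numeral_nonneg: "prime p \<Longrightarrow> 0 \<le> adele_val p (numeral w)"
  using adele_val_of_nat_ge_iff[of p 0 "numeral w"] by (simp add: zero_ereal_def)

text \<open>The map \<open>y \<mapsto> 3 y\<^sup>2 - 2 y\<^sup>3\<close> fixes \<open>0\<close> and \<open>1\<close> and its derivative vanishes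
  there, so it squares the error of an approximation to \<open>0\<close> or \<open>1\<close>.\<close>

lemma ball_indicator:
  assumes p: "prime p"
  shows "\<exists>h :: adele poly. \<forall>x. 0 \<le> adele_val p x \<longrightarrow>
    ereal (real (Suc k)) \<le> adele_val p (poly h x - (if ereal (real m) \<le> adele_val p (x - of_nat a) then 1 else 0))"
proof (induction k)
  case 0
  then show ?case using ball_indicator_mod_p[OF p, of m a] by (simp add: one_ereal_def)
next
  case (Suc k)
  define \<epsilon> :: "adele \<Rightarrow> adele" where "\<epsilon> = (\<lambda>x. if ereal (real m) \<le> adele_val p (x - of_nat a) then 1 else 0)"
  obtain h :: "adele poly" where h: "\<And>x. 0 \<le> adele_val p x \<Longrightarrow> ereal (real (Suc k)) \<le> adele_val p (poly h x - \<epsilon> x)"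
    using Suc unfolding \<epsilon>_def by blast
  have "ereal (real (Suc (Suc k))) \<le> adele_val p (poly (3 * h ^ 2 - 2 * h ^ 3) x - \<epsilon> x)"
    if x: "0 \<le> adele_val p x" for x
  proof -
    define t where "t = poly h x - \<epsilon> x"
    have t: "ereal (real (Suc k)) \<le> adele_val p t" using h[OF x] by (simp add: t_def)
    then have t0: "0 \<le> adele_val p t" by (rule order_trans[rotated]) simp
    have y: "poly h x = t + \<epsilon> x" by (simp add: t_def)
    \<comment> \<open>Expanding at \<open>\<epsilon> x\<close>, the constant and linear terms
      cancel, leaving \<open>t * t\<close> times an integral cofactor.\<close>
    have "poly (3 * h ^ 2 - 2 * h ^ 3) x - \<epsilon> x = t * t * (if \<epsilon> x = 1 then - 3 - 2 * t else 3 - 2 * t)"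
      by (cases "\<epsilon> x = 1")
         (simp_all add: y, simp_all add: \<epsilon>_def algebra_simps power2_eq_square power3_eq_cube split: if_splits)
    moreover have "0 \<le> adele_val p (if \<epsilon> x = 1 then - 3 - 2 * t else 3 - 2 * t)"
      using t0 adele_val_numeral_nonneg[OF p] p
      by (auto simp: adele_val_mult intro!: adele_val_diff)
    \<comment> \<open>Squaring gives precision \<open>2 * (k + 1)\<close>, which is at least
      \<open>k + 2\<close>.\<close>
    moreover have "ereal (real (Suc (Suc k))) \<le> adele_val p (t * t)"
      using t by (cases "adele_val p t") (auto simp: adele_val_mult[OF p])
    ultimately show ?thesis by (simp add: adele_val_mult[OF p] add_increasing2)
  qed
  then show ?case unfolding \<epsilon>_def by blast
qed

text \<open>The approximant imitates a step function: over the residue classes modulo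
  \<open>p ^ m\<close> that meet \<open>S\<close>, it adds a sampled value times the indicator
  polynomial of the class.\<close>

lemma uniformly_continuous_approx:
  fixes f :: "zhat \<Rightarrow> zhat" and k m :: nat
  assumes p: "prime p"
    and f: "\<And>x y. x \<in> S \<Longrightarrow> y \<in> S \<Longrightarrow> ereal (real m) \<le> zhat_val p (x - y) \<Longrightarrow>
      ereal (real k) \<le> zhat_val p (f x - f y)"
  shows "\<exists>h. \<forall>x\<in>S. ereal (real k) \<le> adele_val p (of_zhat (f x) - poly h (of_zhat x))"
proof -
  have "\<forall>a. \<exists>h :: adele poly. \<forall>x. 0 \<le> adele_val p x \<longrightarrow>
      ereal (real (Suc k)) \<le> adele_val p (poly h x - (if ereal (real m) \<le> adele_val p (x - of_nat a) then 1 else 0))"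
    using ball_indicator[OF p] by blast
  from choice[OF this] obtain h where h: "\<And>a x. 0 \<le> adele_val p x \<Longrightarrow>
      ereal (real (Suc k)) \<le> adele_val p (poly (h a) x - (if ereal (real m) \<le> adele_val p (x - of_nat a) then 1 else 0))"
    by blast
  have hk: "ereal (real k) \<le> adele_val p (poly (h a) (of_zhat x) -
      (if ereal (real m) \<le> adele_val p (of_zhat x - of_nat a) then 1 else 0))" for a x
    by (rule order_trans[OF _ h]) (use p in simp_all)
  define near where "near = (\<lambda>a x. ereal (real m) \<le> adele_val p (of_zhat x - of_nat a))"
  define J where "J = {a \<in> {..<p ^ m}. \<exists>x\<in>S. near a x}"
  have "\<forall>a\<in>J. \<exists>x. x \<in> S \<and> near a x" by (auto simp: J_def)
  from bchoice[OF this] obtain r where r: "\<And>a. a \<in> J \<Longrightarrow> r a \<in> S" "\<And>a. a \<in> J \<Longrightarrow> near a (r a)"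
    by blast
  define H where "H = (\<Sum>a\<in>J. smult (of_zhat (f (r a))) (h a))"
  have "ereal (real k) \<le> adele_val p (of_zhat (f x) - poly H (of_zhat x))" if x: "x \<in> S" for x
  proof -
    obtain i where i: "i < p ^ m" "near i x"
      using adele_near_nat[OF p, of "of_zhat x" m] p unfolding near_def by auto
    have iJ: "i \<in> J" using i x by (auto simp: J_def)
    \<comment> \<open>Two distinct residues below \<open>p ^ m\<close> are never congruent, so
      \<open>x\<close> is near only one of them.\<close>
    have far: "\<not> near j x" if j: "j \<in> J - {i}" for j
    proof
      assume "near j x"
      have aux: False if ab: "a < b" "b < p ^ m" "near a x" "near b x" for a b
      proof -
        have "ereal (real m) \<le> adele_val p ((of_zhat x - of_nat a) - (of_zhat x - of_nat b))"
          by (rule adele_val_diff[OF p ab(3,4)[unfolded near_def]])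
        also have "(of_zhat x - of_nat a) - (of_zhat x - of_nat b) = of_nat (b - a)"
          using ab by (simp add: of_nat_diff)
        finally have "p ^ m dvd b - a" using adele_val_of_nat_ge_iff[OF p] by simp
        then show False using ab by (auto dest: dvd_imp_le)
      qed
      show False
        using aux[of i j] aux[of j i] i j \<open>near j x\<close> by (auto simp: J_def neq_iff)
    qed
    have "poly H (of_zhat x) = of_zhat (f (r i)) * poly (h i) (of_zhat x)
        + (\<Sum>a\<in>J - {i}. of_zhat (f (r a)) * poly (h a) (of_zhat x))"
      unfolding H_def poly_sum poly_smult by (rule sum.remove[OF _ iJ]) (simp add: J_def)
    \<comment> \<open>Three errors: the variation of \<open>f\<close> within the class, the defect
      of its own indicator from 1, and that of the other indicators from 0.\<close>
    then have "of_zhat (f x) - poly H (of_zhat x) = of_zhat (f x - f (r i))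
        - of_zhat (f (r i)) * (poly (h i) (of_zhat x) - 1)
        - (\<Sum>a\<in>J - {i}. of_zhat (f (r a)) * poly (h a) (of_zhat x))"
      by (simp add: algebra_simps)
    also have "ereal (real k) \<le> adele_val p \<dots>"
    proof (intro adele_val_diff[OF p] adele_val_sum[OF p])
      have "ereal (real m) \<le> adele_val p ((of_zhat x - of_nat i) - (of_zhat (r i) - of_nat i))"
        by (rule adele_val_diff[OF p i(2)[unfolded near_def] r(2)[OF iJ, unfolded near_def]])
      then show "ereal (real k) \<le> zhat_val p (f x - f (r i))" by (intro f x r iJ) simp
      show "ereal (real k) \<le> adele_val p (of_zhat (f (r i)) * (poly (h i) (of_zhat x) - 1))"
        using hk[of i x] i(2) p by (auto simp: near_def adele_val_mult intro!: add_increasing)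
      show "ereal (real k) \<le> adele_val p (of_zhat (f (r j)) * poly (h j) (of_zhat x))" if "j \<in> J - {i}" for j
        using hk[of j x] far[OF that] p by (auto simp: near_def adele_val_mult intro!: add_increasing)
    qed
    finally show ?thesis .
  qed
  then show ?thesis by blast
qed

text \<open>Uniform continuity from a finite subcover. The compact set is the whole product, but the
  covering neighbourhoods restrict only the component at \<open>p\<close>.\<close>

lemma continuous_family_uniform:
  assumes E: "\<And>p. prime p \<Longrightarrow> E p \<subseteq> carrier (Zp p)" and cpt: "compact (zhat_prod E)"
    and \<phi>: "continuous_family E \<phi>" and p: "prime p"
  shows "\<exists>m::nat. \<forall>x\<in>zhat_prod E. \<forall>y\<in>zhat_prod E. ereal (real m) \<le> zhat_val p (x - y) \<longrightarrow>
    ereal (real k) \<le> zhat_val p (family_fun \<phi> x - family_fun \<phi> y)"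
proof -
  have comp: "component p (of_zhat (family_fun \<phi> x)) = \<phi> p (component p (of_zhat x))"
    if "x \<in> zhat_prod E" for x
    unfolding family_fun_def
    by (rule component_zhat_of) (use that continuous_family_cont(1)[OF \<phi> _ E] p in \<open>auto simp: zhat_prod_def\<close>)
  have "\<exists>m::nat. \<forall>y\<in>zhat_prod E. ereal (real m) \<le> zhat_val p (x - y) \<longrightarrow>
      ereal (real k) \<le> zhat_val p (family_fun \<phi> x - family_fun \<phi> y)" if x: "x \<in> zhat_prod E" for x
  proof -
    have "component p (of_zhat x) \<in> E p" using x p by (simp add: zhat_prod_def)
    from continuous_family_cont(2)[OF \<phi> p E[OF p] this, of k] obtain m :: nat where
      m: "\<And>y. y \<in> E p \<Longrightarrow> ereal (real m) \<le> padic_val p (component p (of_zhat x) \<ominus>\<^bsub>Qp p\<^esub> y) \<Longrightarrow>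
        ereal (real k) \<le> padic_val p (\<phi> p (component p (of_zhat x)) \<ominus>\<^bsub>Qp p\<^esub> \<phi> p y)"
      by blast
    show ?thesis
    proof (intro exI[of _ m] ballI impI)
      fix y assume y: "y \<in> zhat_prod E" and "ereal (real m) \<le> zhat_val p (x - y)"
      then show "ereal (real k) \<le> zhat_val p (family_fun \<phi> x - family_fun \<phi> y)"
        using m[of "component p (of_zhat y)"] p
        by (simp add: component_diff[OF p] comp[OF x] comp[OF y]) (simp add: zhat_prod_def)
    qed
  qed
  then obtain m :: "zhat \<Rightarrow> nat" where m: "\<And>x y. x \<in> zhat_prod E \<Longrightarrow> y \<in> zhat_prod E \<Longrightarrow>
      ereal (real (m x)) \<le> zhat_val p (x - y) \<Longrightarrow> ereal (real k) \<le> zhat_val p (family_fun \<phi> x - family_fun \<phi> y)"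
    by metis
  obtain C where C: "C \<subseteq> zhat_prod E" "finite C"
      "zhat_prod E \<subseteq> (\<Union>x\<in>C. {y. ereal (real (m x)) \<le> zhat_val p (x - y)})"
    by (rule compactE_image[OF cpt, of "zhat_prod E" "\<lambda>x. {y. ereal (real (m x)) \<le> zhat_val p (x - y)}"])
       (use open_zhat_val_ge[OF p] p in auto)
  have "ereal (real k) \<le> zhat_val p (family_fun \<phi> x - family_fun \<phi> y)"
    if x: "x \<in> zhat_prod E" and y: "y \<in> zhat_prod E"
      and xy: "ereal (real (Max (insert 0 (m ` C)))) \<le> zhat_val p (x - y)" for x y
  proof -
    obtain z where z: "z \<in> C" "ereal (real (m z)) \<le> zhat_val p (z - x)" using C(3) x by auto
    have "m z \<le> Max (insert 0 (m ` C))" using C(2) z(1) by (intro Max_ge) auto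
    then have "ereal (real (m z)) \<le> zhat_val p (x - y)" using xy by (auto intro: order_trans[rotated])
    \<comment> \<open>By the ultrametric inequality \<open>y\<close> lies in the same ball around
      \<open>z\<close> as \<open>x\<close>, so no radius has to be halved.\<close>
    then have "ereal (real (m z)) \<le> adele_val p (of_zhat (z - x) + of_zhat (x - y))"
      using z(2) by (intro adele_val_add[OF p])
    then have zy: "ereal (real (m z)) \<le> zhat_val p (z - y)" by simp
    have zE: "z \<in> zhat_prod E" using C(1) z(1) by blast
    have "ereal (real k) \<le> adele_val p (of_zhat (family_fun \<phi> z - family_fun \<phi> y) - of_zhat (family_fun \<phi> z - family_fun \<phi> x))"
      by (intro adele_val_diff[OF p] m zE x y z(2) zy)
    then show ?thesis by simp
  qed
  then show ?thesis by blast
qed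

section \<open>Series expansions\<close>

context adelic_sequence
begin

text \<open>The triangular system obtained by evaluating an expansion at the nodes, written in the
  adeles, where values of polynomials live.\<close>

definition newton_coeffs :: "(zhat \<Rightarrow> zhat) \<Rightarrow> (nat \<Rightarrow> zhat) \<Rightarrow> bool" where
  "newton_coeffs f c \<longleftrightarrow>
     (\<forall>n. of_zhat (c n) = of_zhat (f (\<alpha> n)) - (\<Sum>k<n. of_zhat (c k) * poly (g k) (of_zhat (\<alpha> n))))"

text \<open>The recursion never leaves the profinite integers because the polynomials are integral
  on the set.\<close>

lemma newton_coeffs_exist: "\<exists>c. newton_coeffs f c"
  unfolding newton_coeffs_def
proof (rule dependent_wf_choice[OF wf_less, where P = "\<lambda>c n z. of_zhat z =
    of_zhat (f (\<alpha> n)) - (\<Sum>k<n. of_zhat (c k) * poly (g k) (of_zhat (\<alpha> n)))"])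
  fix c d :: "nat \<Rightarrow> zhat" and n :: nat and r
  assume "\<And>z. (z, n) \<in> {(x, y). x < y} \<Longrightarrow> c z = d z"
  then have "(\<Sum>k<n. of_zhat (c k) * poly (g k) (of_zhat (\<alpha> n))) = (\<Sum>k<n. of_zhat (d k) * poly (g k) (of_zhat (\<alpha> n)))"
    by (intro sum.cong) auto
  then show "(of_zhat r = of_zhat (f (\<alpha> n)) - (\<Sum>k<n. of_zhat (c k) * poly (g k) (of_zhat (\<alpha> n)))) =
      (of_zhat r = of_zhat (f (\<alpha> n)) - (\<Sum>k<n. of_zhat (d k) * poly (g k) (of_zhat (\<alpha> n))))" by simp
next
  fix n :: nat and c :: "nat \<Rightarrow> zhat"
  have "0 \<le> adele_val p (of_zhat (f (\<alpha> n)) - (\<Sum>k<n. of_zhat (c k) * poly (g k) (of_zhat (\<alpha> n))))"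
    if p: "prime p" for p
    using p poly_g_val[OF p \<alpha>_mem]
    by (intro adele_val_diff adele_val_sum) (auto simp: adele_val_mult)
  then have "of_zhat (f (\<alpha> n)) - (\<Sum>k<n. of_zhat (c k) * poly (g k) (of_zhat (\<alpha> n))) \<in> range of_zhat"
    unfolding range_of_zhat_iff by blast
  then show "\<exists>r. of_zhat r = of_zhat (f (\<alpha> n)) - (\<Sum>k<n. of_zhat (c k) * poly (g k) (of_zhat (\<alpha> n)))"
    by (elim rangeE) (rule exI, erule sym)
qed

lemma newton_coeffs_unique:
  assumes "newton_coeffs f c" "newton_coeffs f d"
  shows "c = d"
proof
  show "c n = d n" for n
  proof (induction n rule: less_induct)
    case (less n)
    then have "(\<Sum>k<n. of_zhat (c k) * poly (g k) (of_zhat (\<alpha> n))) = (\<Sum>k<n. of_zhat (d k) * poly (g k) (of_zhat (\<alpha> n)))"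
      by (intro sum.cong) auto
    then have "of_zhat (c n) = of_zhat (d n)" using assms unfolding newton_coeffs_def by metis
    then show ?case by (simp add: of_zhat_inject)
  qed
qed

text \<open>The differences from the coefficients of \<open>h\<close> solve the recursion for
  \<open>f - h\<close>, so they inherit the bound \<open>e\<close>; beyond the degree of
  \<open>h\<close> its own coefficients are zero. The same differences control the
  remainder.\<close>

lemma newton_coeffs_small:
  assumes p: "prime p" and c: "newton_coeffs f c"
    and h: "\<And>x. x \<in> zhat_prod E \<Longrightarrow> e \<le> adele_val p (of_zhat (f x) - poly h (of_zhat x))"
    and N: "degree h < N"
  shows "e \<le> zhat_val p (c N)"
    and "x \<in> zhat_prod E \<Longrightarrow>
      e \<le> adele_val p (of_zhat (f x) - (\<Sum>n<N. of_zhat (c n) * poly (g n) (of_zhat x)))"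
proof -
  obtain b where b: "h = (\<Sum>n<Suc (degree h). smult (b n) (g n))" "\<And>n. n > degree h \<Longrightarrow> b n = 0"
      "\<And>n. b n = poly h (of_zhat (\<alpha> n)) - (\<Sum>k<n. b k * poly (g k) (of_zhat (\<alpha> n)))"
    using g_expansion[of h] by blast
  define d where "d = (\<lambda>n. of_zhat (c n) - b n)"
  have d: "d n = (of_zhat (f (\<alpha> n)) - poly h (of_zhat (\<alpha> n))) - (\<Sum>k<n. d k * poly (g k) (of_zhat (\<alpha> n)))" for n
  proof -
    have "(\<Sum>k<n. d k * poly (g k) (of_zhat (\<alpha> n))) =
        (\<Sum>k<n. of_zhat (c k) * poly (g k) (of_zhat (\<alpha> n))) - (\<Sum>k<n. b k * poly (g k) (of_zhat (\<alpha> n)))"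
      by (simp add: d_def left_diff_distrib sum_subtractf)
    moreover have "of_zhat (c n) = of_zhat (f (\<alpha> n)) - (\<Sum>k<n. of_zhat (c k) * poly (g k) (of_zhat (\<alpha> n)))"
      using c unfolding newton_coeffs_def by blast
    ultimately show ?thesis using b(3)[of n] by (simp add: d_def)
  qed
  have ed: "e \<le> adele_val p (d n)" for n
    by (rule triangular_val[OF p d h])
  show "e \<le> zhat_val p (c N)" using ed[of N] b(2)[OF N] by (simp add: d_def)
  assume x: "x \<in> zhat_prod E"
  have "poly h (of_zhat x) = (\<Sum>n<Suc (degree h). b n * poly (g n) (of_zhat x))"
    by (subst b(1)) (simp add: poly_sum del: sum.lessThan_Suc)
  also have "\<dots> = (\<Sum>n<N. b n * poly (g n) (of_zhat x))"
    by (rule sum.mono_neutral_left) (use N b(2) in auto)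
  finally have "of_zhat (f x) - (\<Sum>n<N. of_zhat (c n) * poly (g n) (of_zhat x)) =
      (of_zhat (f x) - poly h (of_zhat x)) - (\<Sum>n<N. d n * poly (g n) (of_zhat x))"
    by (simp add: d_def left_diff_distrib sum_subtractf)
  also have "e \<le> adele_val p \<dots>"
    using ed poly_g_val[OF p x]
    by (intro adele_val_diff adele_val_sum h x p) (auto simp: adele_val_mult[OF p] intro: add_increasing2)
  finally show "e \<le> adele_val p (of_zhat (f x) - (\<Sum>n<N. of_zhat (c n) * poly (g n) (of_zhat x)))" .
qed

text \<open>A neighbourhood of zero tests finitely many primes at one precision, and at each of them
  everything is small beyond the degree of an approximating polynomial.\<close>

lemma newton_coeffs_expansion:
  assumes c: "newton_coeffs f c"
    and approx: "\<And>p k. prime p \<Longrightarrow>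
      \<exists>h. \<forall>x\<in>zhat_prod E. ereal (real k) \<le> adele_val p (of_zhat (f x) - poly h (of_zhat x))"
  shows "series_expansion (zhat_prod E) g f c"
proof -
  let ?R = "\<lambda>N x. of_zhat (f x) - (\<Sum>n<N. of_zhat (c n) * poly (g n) (of_zhat x))"
  have R: "\<forall>\<^sub>F N in sequentially. c N \<in> U \<and> (\<forall>x\<in>zhat_prod E. ?R N x \<in> of_zhat ` U)"
    if U: "open U" "0 \<in> U" for U
  proof -
    obtain F m where F: "finite F" "F \<subseteq> primes"
        "\<And>y. (\<forall>p\<in>F. ereal (real m) \<le> zhat_val p (0 - y)) \<Longrightarrow> y \<in> U"
      using U unfolding open_zhat_iff by metis
    have "\<forall>\<^sub>F N in sequentially. \<forall>p\<in>F. ereal (real m) \<le> zhat_val p (c N) \<and>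
        (\<forall>x\<in>zhat_prod E. ereal (real m) \<le> adele_val p (?R N x))"
    proof (rule eventually_ball_finite[OF F(1)], rule ballI)
      fix p assume "p \<in> F"
      then have p: "prime p" using F(2) by blast
      obtain h where h: "\<And>x. x \<in> zhat_prod E \<Longrightarrow> ereal (real m) \<le> adele_val p (of_zhat (f x) - poly h (of_zhat x))"
        using approx[OF p, of m] by blast
      show "\<forall>\<^sub>F N in sequentially. ereal (real m) \<le> zhat_val p (c N) \<and>
        (\<forall>x\<in>zhat_prod E. ereal (real m) \<le> adele_val p (?R N x))"
        by (rule eventually_mono[OF eventually_gt_at_top[of "degree h"]])
           (use newton_coeffs_small[OF p c h] in blast)
    qed
    then show ?thesis
    proof (rule eventually_mono)
      fix N assume N: "\<forall>p\<in>F. ereal (real m) \<le> zhat_val p (c N) \<and>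
        (\<forall>x\<in>zhat_prod E. ereal (real m) \<le> adele_val p (?R N x))"
      have "c N \<in> U" by (rule F(3)) (use N F(2) in auto)
      moreover have "?R N x \<in> of_zhat ` U" if x: "x \<in> zhat_prod E" for x
      proof -
        \<comment> \<open>The remainder has to be a profinite integer before it can be tested
          against \<open>U\<close>.\<close>
        have "?R N x \<in> range of_zhat"
          unfolding range_of_zhat_iff using poly_g_val[OF _ x]
          by (auto intro!: adele_val_diff adele_val_sum simp: adele_val_mult)
        then obtain w where w: "?R N x = of_zhat w" by blast
        have "w \<in> U"
        proof (rule F(3), rule ballI)
          fix p assume "p \<in> F"
          then have "ereal (real m) \<le> zhat_val p w" "prime p"
            using N x F(2) unfolding w[symmetric] by auto
          then show "ereal (real m) \<le> zhat_val p (0 - w)" by simp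
        qed
        then show ?thesis using w by blast
      qed
      ultimately show "c N \<in> U \<and> (\<forall>x\<in>zhat_prod E. ?R N x \<in> of_zhat ` U)" by blast
    qed
  qed
  have "c \<longlonglongrightarrow> 0"
    by (rule topological_tendstoI) (rule eventually_mono[OF R], auto)
  moreover have "uniform_series (zhat_prod E) g c f"
    unfolding uniform_series_def by (intro allI impI) (rule eventually_mono[OF R], auto)
  ultimately show ?thesis by (simp add: series_expansion_def)
qed

section \<open>Determination of the coefficients and the infimum formula\<close>

lemma uniform_series_val:
  assumes u: "uniform_series (zhat_prod E) g c f" and p: "prime p"
  shows "\<forall>\<^sub>F N in sequentially. \<forall>x\<in>zhat_prod E.
    ereal (real m) \<le> adele_val p (of_zhat (f x) - (\<Sum>n<N. of_zhat (c n) * poly (g n) (of_zhat x)))"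
proof -
  let ?U = "{y. ereal (real m) \<le> zhat_val p (0 - y)}"
  have "open ?U" by (rule open_zhat_val_ge[OF p])
  moreover have "0 \<in> ?U" using p by simp
  ultimately have "\<forall>\<^sub>F N in sequentially. \<forall>x\<in>zhat_prod E.
      of_zhat (f x) - (\<Sum>n<N. of_zhat (c n) * poly (g n) (of_zhat x)) \<in> of_zhat ` ?U"
    using u unfolding uniform_series_def by blast
  then show ?thesis
  proof (rule eventually_mono, intro ballI)
    fix N x assume "\<forall>x\<in>zhat_prod E. of_zhat (f x) - (\<Sum>n<N. of_zhat (c n) * poly (g n) (of_zhat x)) \<in> of_zhat ` ?U"
      and "x \<in> zhat_prod E"
    then obtain w where "w \<in> ?U" "of_zhat (f x) - (\<Sum>n<N. of_zhat (c n) * poly (g n) (of_zhat x)) = of_zhat w"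
      by blast
    then show "ereal (real m) \<le> adele_val p (of_zhat (f x) - (\<Sum>n<N. of_zhat (c n) * poly (g n) (of_zhat x)))"
      using p by simp
  qed
qed

text \<open>At a node the partial sums are eventually constant, so the remainder there is a fixed
  adele divisible by every power of every prime, hence zero.\<close>

lemma expansion_newton_coeffs:
  assumes "series_expansion (zhat_prod E) g f c"
  shows "newton_coeffs f c"
  unfolding newton_coeffs_def
proof (intro allI adele_eqI)
  fix n p :: nat assume p: "prime p"
  have u: "uniform_series (zhat_prod E) g c f" using assms by (simp add: series_expansion_def)
  let ?r = "of_zhat (f (\<alpha> n)) - (\<Sum>k<n. of_zhat (c k) * poly (g k) (of_zhat (\<alpha> n)))"
  have "ereal (real m) \<le> adele_val p (?r - of_zhat (c n))" for m
  proof -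
    have "\<forall>\<^sub>F N in sequentially. n < N \<and> (\<forall>x\<in>zhat_prod E.
        ereal (real m) \<le> adele_val p (of_zhat (f x) - (\<Sum>n<N. of_zhat (c n) * poly (g n) (of_zhat x))))"
      using eventually_gt_at_top uniform_series_val[OF u p] by (rule eventually_conj)
    then obtain N where "n < N" "ereal (real m) \<le>
        adele_val p (of_zhat (f (\<alpha> n)) - (\<Sum>k<N. of_zhat (c k) * poly (g k) (of_zhat (\<alpha> n))))"
      using \<alpha>_mem by (auto dest!: eventually_happens)
    then show ?thesis by (simp add: sum_g_\<alpha> algebra_simps)
  qed
  then have "adele_val p (?r - of_zhat (c n)) = \<infinity>"
    by (intro ereal_top) (meson reals_Archimedean2 ereal_less_eq(3) order_trans less_imp_le)
  then show "component p (of_zhat (c n)) = component p ?r"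
    using component_eq_iff[OF p, of ?r "of_zhat (c n)"] by simp
qed

text \<open>One inequality is \<open>triangular_val\<close> with \<open>e\<close> the infimum of the
  values; the other sums the series at a point, where the polynomials take integral values.\<close>

lemma expansion_val_INF:
  assumes s: "series_expansion (zhat_prod E) g f c" and p: "prime p"
  shows "(INF n. zhat_val p (c n)) = (INF y\<in>zhat_prod E. zhat_val p (f y))"
proof (rule antisym)
  have c: "newton_coeffs f c" by (rule expansion_newton_coeffs[OF s])
  have u: "uniform_series (zhat_prod E) g c f" using s by (simp add: series_expansion_def)
  show "(INF y\<in>zhat_prod E. zhat_val p (f y)) \<le> (INF n. zhat_val p (c n))"
  proof (rule INF_greatest)
    show "(INF y\<in>zhat_prod E. zhat_val p (f y)) \<le> zhat_val p (c n)" for n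
      by (rule triangular_val[OF p, of "\<lambda>n. of_zhat (c n)" "\<lambda>x. of_zhat (f x)"])
         (use c in \<open>unfold newton_coeffs_def, blast intro: INF_lower\<close>)+
  qed
  show "(INF n. zhat_val p (c n)) \<le> (INF y\<in>zhat_prod E. zhat_val p (f y))"
  proof (rule INF_greatest)
    fix y assume y: "y \<in> zhat_prod E"
    let ?e = "INF n. zhat_val p (c n)"
    have le: "min ?e (ereal (real m)) \<le> zhat_val p (f y)" for m
    proof -
      obtain N where N: "ereal (real m) \<le> adele_val p (of_zhat (f y) - (\<Sum>n<N. of_zhat (c n) * poly (g n) (of_zhat y)))"
        using uniform_series_val[OF u p, of m] y by (auto dest!: eventually_happens)
      have ge: "?e \<le> adele_val p (of_zhat (c n) * poly (g n) (of_zhat y))" for n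
        using poly_g_val[OF p y, of n] INF_lower[of n UNIV "\<lambda>n. zhat_val p (c n)"]
        by (simp add: adele_val_mult[OF p] add_increasing2)
      have "min ?e (ereal (real m)) \<le> adele_val p ((of_zhat (f y) - (\<Sum>n<N. of_zhat (c n) * poly (g n) (of_zhat y)))
          + (\<Sum>n<N. of_zhat (c n) * poly (g n) (of_zhat y)))"
        using N ge by (intro adele_val_add[OF p] adele_val_sum[OF p]) (auto intro: min.coboundedI1 min.coboundedI2)
      then show ?thesis by simp
    qed
    show "?e \<le> zhat_val p (f y)"
    proof (cases "zhat_val p (f y) = \<infinity>")
      case False
      then obtain k :: int where k: "zhat_val p (f y) = ereal (of_int k)"
        using adele_val_cases[OF p, of "of_zhat (f y)"] by metis
      \<comment> \<open>The remainder limits \<open>le\<close> to a prescribed precision; one above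
        the finite valuation \<open>k\<close> rules out the truncation and leaves the
        infimum.\<close>
      have "\<not> ereal (real (nat (k + 1))) \<le> ereal (of_int k)" by auto
      then show ?thesis using le[of "nat (k + 1)"] unfolding k by (simp add: min_le_iff_disj)
    qed simp
  qed
qed

end

section \<open>Assembly of the ordering, the basis and the series expansions\<close>

theorem theorem6p2:
  fixes E :: "nat \<Rightarrow> padic set"
  assumes sub: "\<And>p. prime p \<Longrightarrow> E p \<subseteq> carrier (Zp p)"
    and cpt: "compact (zhat_prod E)"
    and inf: "\<And>p. prime p \<Longrightarrow> infinite (E p)"
    and res: "\<And>n::nat. finite {p. prime p \<and> \<not> n < card (mod_p p (E p))}"
  shows "\<exists>\<alpha>. adelic_ordering (zhat_prod E) \<alpha> \<and>
           zhat_basis (int_valued (zhat_prod E)) (ordering_poly \<alpha>) \<and>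
           (\<forall>\<phi>. continuous_family E \<phi> \<longrightarrow>
             (\<exists>!c. series_expansion (zhat_prod E) (ordering_poly \<alpha>) (family_fun \<phi>) c) \<and>
             (\<forall>c. series_expansion (zhat_prod E) (ordering_poly \<alpha>) (family_fun \<phi>) c \<longrightarrow>
               (\<forall>n. of_zhat (c n) =
                  of_zhat (family_fun \<phi> (\<alpha> n))
                  - (\<Sum>k<n. of_zhat (c k) * poly (ordering_poly \<alpha> k) (of_zhat (\<alpha> n)))) \<and>
               (\<forall>p. prime p \<longrightarrow>
                  (INF n. zhat_val p (c n)) =
                  (INF y\<in>zhat_prod E. zhat_val p (family_fun \<phi> y)))))"
proof -
  interpret padic_product E by unfold_locales (fact sub inf res)+
  obtain \<alpha> :: "nat \<Rightarrow> zhat" where \<alpha>: "\<forall>n. \<alpha> n \<in> zhat_prod E \<and> (\<forall>p y. prime p \<longrightarrow> y \<in> zhat_prod E \<longrightarrow>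
      zhat_val p (\<Prod>k<n. \<alpha> n - \<alpha> k) \<le> zhat_val p (\<Prod>k<n. y - \<alpha> k))"
    using ordering_exists by blast
  interpret adelic_sequence E \<alpha> by unfold_locales (use \<alpha> in blast)+
  show ?thesis
  proof (intro exI[of _ \<alpha>] conjI allI impI)
    fix \<phi> assume \<phi>: "continuous_family E \<phi>"
    \<comment> \<open>Compactness enters here: it makes the function uniformly continuous at
      \<open>p\<close>, hence approximable by polynomials at every precision.\<close>
    have approx: "\<exists>h. \<forall>x\<in>zhat_prod E. ereal (real k) \<le> adele_val p (of_zhat (family_fun \<phi> x) - poly h (of_zhat x))"
      if p: "prime p" for p k
    proof -
      obtain m :: nat where "\<forall>x\<in>zhat_prod E. \<forall>y\<in>zhat_prod E. ereal (real m) \<le> zhat_val p (x - y) \<longrightarrow>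
          ereal (real k) \<le> zhat_val p (family_fun \<phi> x - family_fun \<phi> y)"
        using continuous_family_uniform[OF sub cpt \<phi> p] by blast
      then show ?thesis by (intro uniformly_continuous_approx[OF p, of _ m]) blast
    qed
    obtain c where c: "newton_coeffs (family_fun \<phi>) c" using newton_coeffs_exist by blast
    show "\<exists>!c. series_expansion (zhat_prod E) g (family_fun \<phi>) c"
      using newton_coeffs_expansion[OF c approx] newton_coeffs_unique expansion_newton_coeffs by blast
  next
    fix \<phi> c n assume "series_expansion (zhat_prod E) g (family_fun \<phi>) c"
    from expansion_newton_coeffs[OF this]
    show "of_zhat (c n) = of_zhat (family_fun \<phi> (\<alpha> n)) - (\<Sum>k<n. of_zhat (c k) * poly (g k) (of_zhat (\<alpha> n)))"
      unfolding newton_coeffs_def by blast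
  qed (use adelic_ordering basis expansion_val_INF in blast)+
qed

end
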